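(* Let $A=\mathbb{C}_\lambda[S^2]$ be the unit fuzzy sphere with its 3D differential calculus with central basis $s^1,s^2,s^3$, and let $g=g_{ij}s^i\otimes s^j$ be any quantum metric, where $(g_{ij})$ is a real symmetric invertible $3\times 3$ matrix. Among left connections $\nabla s^i=-\tfrac12\Gamma^i{}_{jk}s^j\otimes s^k$ with constant coefficients $\Gamma^i{}_{jk}\in\mathbb{C}$, there is a unique quantum Levi-Civita connection for $g$ (that is, a bimodule connection that is torsion free and metric compatible). With $\Gamma_{ijk}:=g_{im}\Gamma^m{}_{jk}$, it is given by $$\Gamma_{ijk}=2\epsilon_{ikm}g_{mj}+\mathrm{Tr}(g)\,\epsilon_{ijk}.$$ These coefficients are real, and hence the connection is $*$-preserving.
   Context: Repeated indices in $\{1,2,3\}$ are summed; $\epsilon_{ijk}$ is the totally antisymmetric symbol with $\epsilon_{123}=1$; $\imath=\sqrt{-1}$; $\lambda_p$ is a real parameter with $\lambda_p\neq 0,\pm1$. Algebra. $A=\mathbb{C}_\lambda[S^2]$ is the unital $*$-algebra over $\mathbb{C}$ generated by self-adjoint $x_1,x_2,x_3$ with relations $[x_i,x_j]=2\imath\lambda_p\epsilon_{ijk}x_k$ and $\sum_i x_i^2=1-\lambda_p^2$. Calculus. $\Omega^1$ is the $A$-bimodule that is free as a left module with basis $s^1,s^2,s^3$ and with $[s^i,x_j]=0$. The map $\mathrm{d}:A\to\Omega^1$ is the derivation with $\mathrm{d}x_i=\epsilon_{ijk}x_js^k$. The exterior algebra $\Omega$ is generated over $A$ by the central $s^i$ with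 $s^i\wedge s^j+s^j\wedge s^i=0$, and $\mathrm{d}s^i=-\tfrac12\epsilon_{ijk}s^j\wedge s^k$, with $\mathrm{d}$ extended by the graded Leibniz rule. The $*$-structure extends with $s^{i*}=s^i$. Metric. A quantum metric is $g=g_{ij}s^i\otimes s^j\in\Omega^1\otimes_A\Omega^1$ with $(g_{ij})$ a real symmetric invertible matrix; $\mathrm{Tr}(g)=\sum_i g_{ii}$. Connections. A left connection is a linear map $\nabla:\Omega^1\to\Omega^1\otimes_A\Omega^1$ with $\nabla(a\omega)=\mathrm{d}a\otimes\omega+a\nabla\omega$. It is a bimodule connection if there is a bimodule map $\sigma:\Omega^1\otimes_A\Omega^1\to\Omega^1\otimes_A\Omega^1$ with $\nabla(\omega a)=(\nabla\omega)a+\sigma(\omega\otimes\mathrm{d}a)$ for all $a\in A$, $\omega\in\Omega^1$ (such $\sigma$ is unique if it exists). It is torsion free if $\wedge\nabla-\mathrm{d}=0$ as a map $\Omega^1\to\Omega^2$. It is metric compatible with $g$ if $(\nabla\otimes\mathrm{id})g+(\sigma\otimes\mathrm{id})(\mathrm{id}\otimes\nabla)g=0$. It is $*$-preserving if $\sigma\circ\mathrm{flip}( *\otimes * )\circ\nabla=\nabla\circ *$ on $\Omega^1$, where $\mathrm{flip}( *\otimes* )(\omega\otimes\eta)=\eta^*\otimes\omega^*$. *)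

theory Defs
  imports
    "HOL-Analysis.Analysis"
    "HOL-Library.Poly_Mapping"
    "HOL-Algebra.QuotRing"
begin

text \<open>
  Indices range over the three-element type \<open>3\<close>, whose elements are \<open>1\<close>, \<open>2\<close> and \<open>3\<close> (with \<open>3 = 0\<close>
  modulo three).
\<close>

definition eps :: "3 \<Rightarrow> 3 \<Rightarrow> 3 \<Rightarrow> real" where
  "eps i j k =
     (if (i, j, k) \<in> {(1, 2, 3), (2, 3, 1), (3, 1, 2)} then 1
      else if (i, j, k) \<in> {(1, 3, 2), (3, 2, 1), (2, 1, 3)} then - 1
      else 0)"


section \<open>The unit fuzzy sphere\<close>

text \<open>
  The real parameter \<open>\<lambda>\<^sub>p\<close> is written \<open>l\<close> throughout.

  The free unital complex algebra on three generators is the monoid algebra of the free monoid of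
  words.  The monoid law on words is written additively because the convolution product of
  \<open>poly_mapping\<close> expects it so.
\<close>

datatype word = Word (letters: "3 list")

instantiation word :: monoid_add
begin

definition zero_word :: word where "zero_word = Word []"

definition plus_word :: "word \<Rightarrow> word \<Rightarrow> word" where
  "plus_word v w = Word (letters v @ letters w)"

instance
  by standard (simp_all add: zero_word_def plus_word_def)

end

type_synonym free_alg = "word \<Rightarrow>\<^sub>0 complex"

definition free_gen :: "3 \<Rightarrow> free_alg" where
  "free_gen i = Poly_Mapping.single (Word [i]) 1"

definition free_const :: "complex \<Rightarrow> free_alg" where
  "free_const c = Poly_Mapping.single 0 c"

text \<open>The star is conjugate-linear, reverses words and fixes the generators.\<close>

definition free_star :: "free_alg \<Rightarrow> free_alg" where
  "free_star f = Poly_Mapping.map_key (\<lambda>w. Word (rev (letters w))) (Poly_Mapping.map cnj f)"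

definition free_ring :: "free_alg ring" where
  "free_ring = \<lparr>carrier = UNIV, mult = (*), one = 1, zero = 0, add = (+)\<rparr>"

definition sphere_relations :: "real \<Rightarrow> free_alg set" where
  "sphere_relations l =
     {free_gen i * free_gen j - free_gen j * free_gen i
        - (\<Sum>k\<in>UNIV. free_const (2 * \<i> * of_real l * of_real (eps i j k)) * free_gen k) | i j. True}
     \<union> {(\<Sum>i\<in>UNIV. free_gen i * free_gen i) - free_const (1 - (of_real l)\<^sup>2)}"

definition sphere_ideal :: "real \<Rightarrow> free_alg set" where
  "sphere_ideal l = Idl\<^bsub>free_ring\<^esub> (sphere_relations l)"

definition fuzzy_sphere :: "real \<Rightarrow> free_alg set ring" (\<open>\<A>\<close>) where
  "\<A> l = free_ring Quot (sphere_ideal l)"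

definition coord :: "real \<Rightarrow> 3 \<Rightarrow> free_alg set" where
  "coord l i = sphere_ideal l +>\<^bsub>free_ring\<^esub> free_gen i"

definition scalar :: "real \<Rightarrow> complex \<Rightarrow> free_alg set" where
  "scalar l c = sphere_ideal l +>\<^bsub>free_ring\<^esub> free_const c"

text \<open>
  The ideal is stable under the star, so the image of a coset under the star is again a coset.
\<close>

definition star :: "free_alg set \<Rightarrow> free_alg set" where
  "star a = free_star ` a"


section \<open>One-forms and their tensor products\<close>

text \<open>
  \<open>\<omega>\<close> stands for \<open>\<omega>\<^sub>i s\<^sup>i\<close>, with coefficients on the left.  As the \<open>s\<^sup>i\<close> commute with the algebra,
  the right action is \<open>(\<omega>\<^sub>i s\<^sup>i) a = (\<omega>\<^sub>i a) s\<^sup>i\<close>.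
\<close>

type_synonym form1 = "3 \<Rightarrow> free_alg set"
type_synonym tensor2 = "3 \<Rightarrow> 3 \<Rightarrow> free_alg set"
type_synonym tensor3 = "3 \<Rightarrow> 3 \<Rightarrow> 3 \<Rightarrow> free_alg set"

definition Omega1 :: "real \<Rightarrow> form1 set" where
  "Omega1 l = {\<omega>. \<forall>i. \<omega> i \<in> carrier (\<A> l)}"

definition sform :: "real \<Rightarrow> 3 \<Rightarrow> form1" where
  "sform l i = (\<lambda>j. if j = i then \<one>\<^bsub>\<A> l\<^esub> else \<zero>\<^bsub>\<A> l\<^esub>)"

definition add1 :: "real \<Rightarrow> form1 \<Rightarrow> form1 \<Rightarrow> form1" where
  "add1 l \<omega> \<eta> = (\<lambda>i. \<omega> i \<oplus>\<^bsub>\<A> l\<^esub> \<eta> i)"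

definition lmult1 :: "real \<Rightarrow> free_alg set \<Rightarrow> form1 \<Rightarrow> form1" where
  "lmult1 l a \<omega> = (\<lambda>i. a \<otimes>\<^bsub>\<A> l\<^esub> \<omega> i)"

definition rmult1 :: "real \<Rightarrow> form1 \<Rightarrow> free_alg set \<Rightarrow> form1" where
  "rmult1 l \<omega> a = (\<lambda>i. \<omega> i \<otimes>\<^bsub>\<A> l\<^esub> a)"

text \<open>\<open>(\<omega>\<^sub>i s\<^sup>i)\<^sup>* = s\<^sup>i \<omega>\<^sub>i\<^sup>* = \<omega>\<^sub>i\<^sup>* s\<^sup>i\<close>.\<close>

definition star1 :: "form1 \<Rightarrow> form1" where
  "star1 \<omega> = (\<lambda>i. star (\<omega> i))"

text \<open>
  The tensor product over the algebra of the free bimodule on the central basis \<open>s\<^sup>i\<close> with itself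
  is the free bimodule on the central basis \<open>s\<^sup>i \<otimes> s\<^sup>j\<close>; \<open>T\<close> stands for \<open>T\<^sub>i\<^sub>j s\<^sup>i \<otimes> s\<^sup>j\<close>, and
  \<open>\<omega>\<^sub>i s\<^sup>i \<otimes> \<eta>\<^sub>j s\<^sup>j = \<omega>\<^sub>i \<eta>\<^sub>j s\<^sup>i \<otimes> s\<^sup>j\<close>.  Likewise for threefold tensors.
\<close>

definition Omega11 :: "real \<Rightarrow> tensor2 set" where
  "Omega11 l = {T. \<forall>i j. T i j \<in> carrier (\<A> l)}"

definition tensor :: "real \<Rightarrow> form1 \<Rightarrow> form1 \<Rightarrow> tensor2" where
  "tensor l \<omega> \<eta> = (\<lambda>i j. \<omega> i \<otimes>\<^bsub>\<A> l\<^esub> \<eta> j)"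

definition add2 :: "real \<Rightarrow> tensor2 \<Rightarrow> tensor2 \<Rightarrow> tensor2" where
  "add2 l S T = (\<lambda>i j. S i j \<oplus>\<^bsub>\<A> l\<^esub> T i j)"

definition lmult2 :: "real \<Rightarrow> free_alg set \<Rightarrow> tensor2 \<Rightarrow> tensor2" where
  "lmult2 l a T = (\<lambda>i j. a \<otimes>\<^bsub>\<A> l\<^esub> T i j)"

definition rmult2 :: "real \<Rightarrow> tensor2 \<Rightarrow> free_alg set \<Rightarrow> tensor2" where
  "rmult2 l T a = (\<lambda>i j. T i j \<otimes>\<^bsub>\<A> l\<^esub> a)"

definition tensor12 :: "real \<Rightarrow> form1 \<Rightarrow> tensor2 \<Rightarrow> tensor3" where
  "tensor12 l \<omega> T = (\<lambda>i j k. \<omega> i \<otimes>\<^bsub>\<A> l\<^esub> T j k)"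

definition tensor21 :: "real \<Rightarrow> tensor2 \<Rightarrow> form1 \<Rightarrow> tensor3" where
  "tensor21 l T \<omega> = (\<lambda>i j k. T i j \<otimes>\<^bsub>\<A> l\<^esub> \<omega> k)"

text \<open>
  \<open>flip (* \<otimes> *)\<close>:
  it sends \<open>T\<^sub>i\<^sub>j s\<^sup>i \<otimes> s\<^sup>j\<close> to \<open>s\<^sup>j \<otimes> (T\<^sub>i\<^sub>j s\<^sup>i)\<^sup>* = T\<^sub>i\<^sub>j\<^sup>* s\<^sup>j \<otimes> s\<^sup>i\<close>.
\<close>

definition flip_star :: "tensor2 \<Rightarrow> tensor2" where
  "flip_star T = (\<lambda>i j. star (T j i))"


section \<open>The differential calculus\<close>

definition is_differential :: "real \<Rightarrow> (free_alg set \<Rightarrow> form1) \<Rightarrow> bool" where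
  "is_differential l D \<longleftrightarrow>
     D \<in> carrier (\<A> l) \<rightarrow>\<^sub>E Omega1 l \<and>
     (\<forall>a\<in>carrier (\<A> l). \<forall>b\<in>carrier (\<A> l). D (a \<oplus>\<^bsub>\<A> l\<^esub> b) = add1 l (D a) (D b)) \<and>
     (\<forall>c. \<forall>a\<in>carrier (\<A> l). D (scalar l c \<otimes>\<^bsub>\<A> l\<^esub> a) = lmult1 l (scalar l c) (D a)) \<and>
     (\<forall>a\<in>carrier (\<A> l). \<forall>b\<in>carrier (\<A> l).
        D (a \<otimes>\<^bsub>\<A> l\<^esub> b) = add1 l (rmult1 l (D a) b) (lmult1 l a (D b))) \<and>
     (\<forall>i. D (coord l i) =
        (\<lambda>k. \<Oplus>\<^bsub>\<A> l\<^esub>j\<in>UNIV. scalar l (of_real (eps i j k)) \<otimes>\<^bsub>\<A> l\<^esub> coord l j))"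

definition dA :: "real \<Rightarrow> free_alg set \<Rightarrow> form1" where
  "dA l = (THE D. is_differential l D)"

text \<open>
  The degree two part of the exterior algebra is the quotient of the twofold tensors by the
  sub-bimodule generated by the \<open>s\<^sup>i \<otimes> s\<^sup>j + s\<^sup>j \<otimes> s\<^sup>i\<close>, i.e. by the set of all
  \<open>C\<^sub>i\<^sub>j (s\<^sup>i \<otimes> s\<^sup>j + s\<^sup>j \<otimes> s\<^sup>i)\<close>; the wedge product is the quotient map to cosets.
\<close>

definition wedge_relations :: "real \<Rightarrow> tensor2 set" where
  "wedge_relations l = {(\<lambda>i j. C i j \<oplus>\<^bsub>\<A> l\<^esub> C j i) | C. C \<in> Omega11 l}"

definition wedge :: "real \<Rightarrow> tensor2 \<Rightarrow> tensor2 set" where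
  "wedge l T = {T' \<in> Omega11 l. (\<lambda>i j. T' i j \<ominus>\<^bsub>\<A> l\<^esub> T i j) \<in> wedge_relations l}"

text \<open>
  Graded Leibniz rule: \<open>d (\<omega>\<^sub>i s\<^sup>i) = d \<omega>\<^sub>i \<and> s\<^sup>i + \<omega>\<^sub>i d s\<^sup>i\<close> with
  \<open>d s\<^sup>i = - 1/2 \<epsilon>\<^sub>i\<^sub>j\<^sub>k s\<^sup>j \<and> s\<^sup>k\<close>, the sum being formed on representing tensors.
\<close>

definition dOmega1 :: "real \<Rightarrow> form1 \<Rightarrow> tensor2 set" where
  "dOmega1 l \<omega> = wedge l (\<lambda>j k. \<Oplus>\<^bsub>\<A> l\<^esub>i\<in>UNIV.
     tensor l (dA l (\<omega> i)) (sform l i) j k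
       \<oplus>\<^bsub>\<A> l\<^esub> \<omega> i \<otimes>\<^bsub>\<A> l\<^esub> scalar l (- 1 / 2 * of_real (eps i j k)))"


section \<open>Connections\<close>

definition left_connection :: "real \<Rightarrow> (form1 \<Rightarrow> tensor2) \<Rightarrow> bool" where
  "left_connection l nabla \<longleftrightarrow>
     nabla \<in> Omega1 l \<rightarrow>\<^sub>E Omega11 l \<and>
     (\<forall>\<omega>\<in>Omega1 l. \<forall>\<eta>\<in>Omega1 l. nabla (add1 l \<omega> \<eta>) = add2 l (nabla \<omega>) (nabla \<eta>)) \<and>
     (\<forall>c. \<forall>\<omega>\<in>Omega1 l. nabla (lmult1 l (scalar l c) \<omega>) = lmult2 l (scalar l c) (nabla \<omega>)) \<and>
     (\<forall>a\<in>carrier (\<A> l). \<forall>\<omega>\<in>Omega1 l.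
        nabla (lmult1 l a \<omega>) = add2 l (tensor l (dA l a) \<omega>) (lmult2 l a (nabla \<omega>)))"

definition bimodule_map2 :: "real \<Rightarrow> (tensor2 \<Rightarrow> tensor2) \<Rightarrow> bool" where
  "bimodule_map2 l \<sigma> \<longleftrightarrow>
     \<sigma> \<in> Omega11 l \<rightarrow>\<^sub>E Omega11 l \<and>
     (\<forall>S\<in>Omega11 l. \<forall>T\<in>Omega11 l. \<sigma> (add2 l S T) = add2 l (\<sigma> S) (\<sigma> T)) \<and>
     (\<forall>a\<in>carrier (\<A> l). \<forall>T\<in>Omega11 l. \<sigma> (lmult2 l a T) = lmult2 l a (\<sigma> T)) \<and>
     (\<forall>a\<in>carrier (\<A> l). \<forall>T\<in>Omega11 l. \<sigma> (rmult2 l T a) = rmult2 l (\<sigma> T) a)"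

definition is_braiding :: "real \<Rightarrow> (form1 \<Rightarrow> tensor2) \<Rightarrow> (tensor2 \<Rightarrow> tensor2) \<Rightarrow> bool" where
  "is_braiding l nabla \<sigma> \<longleftrightarrow>
     bimodule_map2 l \<sigma> \<and>
     (\<forall>a\<in>carrier (\<A> l). \<forall>\<omega>\<in>Omega1 l.
        nabla (rmult1 l \<omega> a) = add2 l (rmult2 l (nabla \<omega>) a) (\<sigma> (tensor l \<omega> (dA l a))))"

definition bimodule_connection :: "real \<Rightarrow> (form1 \<Rightarrow> tensor2) \<Rightarrow> bool" where
  "bimodule_connection l nabla \<longleftrightarrow> left_connection l nabla \<and> (\<exists>\<sigma>. is_braiding l nabla \<sigma>)"

definition braiding :: "real \<Rightarrow> (form1 \<Rightarrow> tensor2) \<Rightarrow> tensor2 \<Rightarrow> tensor2" where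
  "braiding l nabla = (THE \<sigma>. is_braiding l nabla \<sigma>)"

definition torsion_free :: "real \<Rightarrow> (form1 \<Rightarrow> tensor2) \<Rightarrow> bool" where
  "torsion_free l nabla \<longleftrightarrow> (\<forall>\<omega>\<in>Omega1 l. wedge l (nabla \<omega>) = dOmega1 l \<omega>)"

text \<open>\<open>\<sigma> \<otimes> id\<close>, using \<open>U = (U\<^sub>i\<^sub>j\<^sub>k s\<^sup>i \<otimes> s\<^sup>j) \<otimes> s\<^sup>k\<close>.\<close>

definition map_id :: "(tensor2 \<Rightarrow> tensor2) \<Rightarrow> tensor3 \<Rightarrow> tensor3" where
  "map_id \<sigma> U = (\<lambda>i j k. \<sigma> (\<lambda>p q. U p q k) i j)"

text \<open>
  \<open>\<nabla> \<otimes> id\<close> and \<open>id \<otimes> \<nabla>\<close> are not separately well defined on a tensor product over the algebra (only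
  the combination in metric compatibility is), so they are evaluated on the given expression
  \<open>g\<^sub>i\<^sub>j s\<^sup>i \<otimes> s\<^sup>j = (g\<^sub>i\<^sub>j s\<^sup>i) \<otimes> s\<^sup>j\<close> of the metric.
\<close>

definition nabla_id_metric :: "real \<Rightarrow> real^3^3 \<Rightarrow> (form1 \<Rightarrow> tensor2) \<Rightarrow> tensor3" where
  "nabla_id_metric l g nabla = (\<lambda>p q r. \<Oplus>\<^bsub>\<A> l\<^esub>i\<in>UNIV. \<Oplus>\<^bsub>\<A> l\<^esub>j\<in>UNIV.
     tensor21 l (nabla (lmult1 l (scalar l (of_real (g $ i $ j))) (sform l i))) (sform l j) p q r)"

definition id_nabla_metric :: "real \<Rightarrow> real^3^3 \<Rightarrow> (form1 \<Rightarrow> tensor2) \<Rightarrow> tensor3" where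
  "id_nabla_metric l g nabla = (\<lambda>p q r. \<Oplus>\<^bsub>\<A> l\<^esub>i\<in>UNIV. \<Oplus>\<^bsub>\<A> l\<^esub>j\<in>UNIV.
     tensor12 l (lmult1 l (scalar l (of_real (g $ i $ j))) (sform l i)) (nabla (sform l j)) p q r)"

definition metric_compatible :: "real \<Rightarrow> real^3^3 \<Rightarrow> (form1 \<Rightarrow> tensor2) \<Rightarrow> bool" where
  "metric_compatible l g nabla \<longleftrightarrow>
     (\<forall>p q r. nabla_id_metric l g nabla p q r
        \<oplus>\<^bsub>\<A> l\<^esub> map_id (braiding l nabla) (id_nabla_metric l g nabla) p q r = \<zero>\<^bsub>\<A> l\<^esub>)"

definition star_preserving :: "real \<Rightarrow> (form1 \<Rightarrow> tensor2) \<Rightarrow> bool" where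
  "star_preserving l nabla \<longleftrightarrow>
     (\<forall>\<omega>\<in>Omega1 l. braiding l nabla (flip_star (nabla \<omega>)) = nabla (star1 \<omega>))"

definition quantum_metric :: "real^3^3 \<Rightarrow> bool" where
  "quantum_metric g \<longleftrightarrow> transpose g = g \<and> invertible g"

definition quantum_Levi_Civita :: "real \<Rightarrow> real^3^3 \<Rightarrow> (form1 \<Rightarrow> tensor2) \<Rightarrow> bool" where
  "quantum_Levi_Civita l g nabla \<longleftrightarrow>
     bimodule_connection l nabla \<and> torsion_free l nabla \<and> metric_compatible l g nabla"

text \<open>\<open>\<Gamma> i j k\<close> is the coefficient with first index raised: \<open>\<nabla> s\<^sup>i = - 1/2 \<Gamma> i j k s\<^sup>j \<otimes> s\<^sup>k\<close>.\<close>

definition has_coefficients ::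
    "real \<Rightarrow> (form1 \<Rightarrow> tensor2) \<Rightarrow> (3 \<Rightarrow> 3 \<Rightarrow> 3 \<Rightarrow> complex) \<Rightarrow> bool" where
  "has_coefficients l nabla \<Gamma> \<longleftrightarrow>
     (\<forall>i. nabla (sform l i) = (\<lambda>j k. scalar l (- 1 / 2 * \<Gamma> i j k)))"

definition lower_index ::
    "real^3^3 \<Rightarrow> (3 \<Rightarrow> 3 \<Rightarrow> 3 \<Rightarrow> complex) \<Rightarrow> 3 \<Rightarrow> 3 \<Rightarrow> 3 \<Rightarrow> complex" where
  "lower_index g \<Gamma> i j k = (\<Sum>m\<in>UNIV. of_real (g $ i $ m) * \<Gamma> m j k)"

end

theory Submission
  imports Defs
begin

text \<open>
  The components of the differential are the inner derivations \<open>[x\<^sub>k, _] / (2 \<i> \<lambda>\<^sub>p)\<close>, and the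
  differentials of the coordinates generate the one-forms because \<open>\<lambda>\<^sub>p \<noteq> \<plusminus>1\<close>.  Constant coefficients
  are central, so comparing \<open>\<nabla>(s\<^sup>i a)\<close> with \<open>\<nabla>(a s\<^sup>i)\<close> gives \<open>\<sigma>(s\<^sup>i \<otimes> da) = da \<otimes> s\<^sup>i\<close>: the braiding is
  the flip.  As the algebra is nontrivial, torsion freeness and metric compatibility are then the linear
  equations \<open>\<Gamma>\<^sub>i\<^sub>j\<^sub>k - \<Gamma>\<^sub>i\<^sub>k\<^sub>j = 2 g\<^sub>i\<^sub>m \<epsilon>\<^sub>m\<^sub>j\<^sub>k\<close> and \<open>\<Gamma>\<^sub>i\<^sub>j\<^sub>k = - \<Gamma>\<^sub>k\<^sub>j\<^sub>i\<close>, which a Koszul argument solves.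
\<close>

section \<open>The free algebra\<close>

lemma eps_simps [simp]:
  "eps 1 2 3 = 1" "eps 2 3 1 = 1" "eps 3 1 2 = 1"
  "eps 1 3 2 = -1" "eps 3 2 1 = -1" "eps 2 1 3 = -1"
  "eps i i j = 0" "eps i j i = 0" "eps j i i = 0"
  unfolding eps_def by auto

lemma word_add_letters: "v + w = Word (letters v @ letters w)"
  by (simp add: plus_word_def)

lemma free_const_add: "free_const (a + b) = free_const a + free_const b"
  by (simp add: free_const_def single_add)

lemma free_const_minus: "free_const (- a) = - free_const a"
  by (simp add: free_const_def single_uminus)

lemma free_const_mult: "free_const (a * b) = free_const a * free_const b"
  by (simp add: free_const_def mult_single)

lemma free_const_0 [simp]: "free_const 0 = 0"
  by (simp add: free_const_def)

lemma free_const_1 [simp]: "free_const 1 = 1"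
  by (simp add: free_const_def)

lemma free_const_sum: "free_const (sum f S) = (\<Sum>i\<in>S. free_const (f i))"
  by (induction S rule: infinite_finite_induct) (auto simp: free_const_add)

text \<open>A finitely supported function is a sum of monomials, so additive identities need
  checking on \<open>Poly_Mapping.single\<close> only.\<close>

lemma poly_mapping_single_induct [case_names single add]:
  assumes "\<And>k c. P (Poly_Mapping.single k c)" and "\<And>f g. P f \<Longrightarrow> P g \<Longrightarrow> P (f + g)"
  shows "P (f :: 'a \<Rightarrow>\<^sub>0 'b::comm_monoid_add)"
proof (induction f rule: update_induct)
  case const
  then show ?case using assms(1)[of undefined 0] by simp
next
  case (update f a b)
  have "Poly_Mapping.update a b f = Poly_Mapping.single a b + f"
    using update.hyps by (auto intro!: poly_mapping_eqI simp: lookup_update lookup_add lookup_single when_def in_keys_iff)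
  then show ?case using assms update.IH by metis
qed

text \<open>Each monomial is a constant multiplied by generators. This is the form of induction that
  suits derivations, which are determined by their values on generators.\<close>

lemma free_alg_induct [case_names const gen add mult]:
  assumes const: "\<And>c. P (free_const c)" and gen: "\<And>i. P (free_gen i)"
    and add: "\<And>f g. P f \<Longrightarrow> P g \<Longrightarrow> P (f + g)" and mult: "\<And>f g. P f \<Longrightarrow> P g \<Longrightarrow> P (f * g)"
  shows "P f"
proof (induction f rule: poly_mapping_single_induct)
  case (single w c)
  have "P (Poly_Mapping.single (Word is) c)" for "is"
  proof (induction "is")
    case Nil
    then show ?case using const[of c] by (simp add: free_const_def zero_word_def)
  next
    case (Cons i "is")
    have "Poly_Mapping.single (Word (i # is)) c = free_gen i * Poly_Mapping.single (Word is) c"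
      by (simp add: free_gen_def mult_single word_add_letters)
    then show ?case using mult[OF gen Cons.IH] by simp
  qed
  then show ?case by (metis word.exhaust)
qed (rule add)

lemma free_const_central: "f * free_const c = free_const c * f"
proof (induction f rule: poly_mapping_single_induct)
  case (single w a)
  then show ?case by (simp add: free_const_def mult_single mult.commute)
qed (simp add: algebra_simps)

lemma free_const_left_commute: "f * (free_const c * h) = free_const c * (f * h)"
  by (metis free_const_central mult.assoc)

section \<open>The star on the free algebra\<close>

lemma lookup_free_star:
  "Poly_Mapping.lookup (free_star f) w = cnj (Poly_Mapping.lookup f (Word (rev (letters w))))"
proof -
  have "inj (\<lambda>w. Word (rev (letters w)))"
    by (auto intro!: injI simp: word.expand)
  then show ?thesis by (simp add: free_star_def map_key.rep_eq map.rep_eq when_def)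
qed

lemma free_star_single:
  "free_star (Poly_Mapping.single w c) = Poly_Mapping.single (Word (rev (letters w))) (cnj c)"
  by (rule poly_mapping_eqI) (auto simp: lookup_free_star lookup_single when_def)

lemma free_star_add: "free_star (f + g) = free_star f + free_star g"
  by (rule poly_mapping_eqI) (simp add: lookup_free_star lookup_add)

lemma free_star_0 [simp]: "free_star 0 = 0"
  by (rule poly_mapping_eqI) (simp add: lookup_free_star)

lemma free_star_diff: "free_star (f - g) = free_star f - free_star g"
  by (rule poly_mapping_eqI) (simp add: lookup_free_star lookup_minus)

lemma free_star_sum: "free_star (sum f S) = (\<Sum>i\<in>S. free_star (f i))"
  by (induction S rule: infinite_finite_induct) (auto simp: free_star_add)

lemma free_star_involutive [simp]: "free_star (free_star f) = f"
  by (rule poly_mapping_eqI) (simp add: lookup_free_star)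

lemma free_star_const [simp]: "free_star (free_const c) = free_const (cnj c)"
  by (simp add: free_const_def free_star_single zero_word_def)

lemma free_star_gen [simp]: "free_star (free_gen i) = free_gen i"
  by (simp add: free_gen_def free_star_single)

lemma free_star_mult: "free_star (f * g) = free_star g * free_star f"
proof (induction f rule: poly_mapping_single_induct)
  case (single v a)
  show ?case
  proof (induction g rule: poly_mapping_single_induct)
    case (single w b)
    then show ?case
      by (simp add: mult_single free_star_single word_add_letters mult.commute)
  qed (simp add: algebra_simps free_star_add)
qed (simp add: algebra_simps free_star_add)

section \<open>Cosets of the sphere ideal\<close>

lemma free_ring_simps [simp]:
  "carrier free_ring = UNIV" "f \<otimes>\<^bsub>free_ring\<^esub> g = f * g" "f \<oplus>\<^bsub>free_ring\<^esub> g = f + g"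
  "\<one>\<^bsub>free_ring\<^esub> = 1" "\<zero>\<^bsub>free_ring\<^esub> = 0"
  by (simp_all add: free_ring_def)

lemma ring_free_ring: "ring free_ring"
  by (rule ringI, rule abelian_groupI)
     (auto intro!: Group.monoidI exI[of _ "- x" for x] simp: algebra_simps)

lemma ideal_sphere_ideal: "ideal (sphere_ideal l) free_ring"
  unfolding sphere_ideal_def by (rule ring.genideal_ideal[OF ring_free_ring]) simp

lemma sphere_relations_subset: "sphere_relations l \<subseteq> sphere_ideal l"
  unfolding sphere_ideal_def by (rule ring.genideal_self[OF ring_free_ring]) simp

text \<open>Closure under negation comes from absorbing multiplication by \<open>-1\<close>.\<close>

lemma ideal_free_ringI:
  assumes "0 \<in> J" and "\<And>f g. f \<in> J \<Longrightarrow> g \<in> J \<Longrightarrow> f + g \<in> J"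
    and "\<And>f h. f \<in> J \<Longrightarrow> h * f \<in> J" and "\<And>f h. f \<in> J \<Longrightarrow> f * h \<in> J"
  shows "ideal J free_ring"
proof (rule idealI[OF ring_free_ring])
  interpret ring free_ring by (rule ring_free_ring)
  have neg: "\<ominus>\<^bsub>free_ring\<^esub> f = - f" for f
    by (rule minus_equality) auto
  have "- f \<in> J" if "f \<in> J" for f
    using assms(3)[OF that, of "-1"] by simp
  then show "subgroup J (add_monoid free_ring)"
    by (intro add.subgroupI) (use assms neg in \<open>auto simp: a_inv_def[symmetric]\<close>)
qed (use assms in auto)

text \<open>The closure conditions make \<open>Collect P\<close> an ideal containing the relations,
  and the generated ideal is the smallest such.\<close>

lemma sphere_ideal_induct [consumes 1, case_names relation zero add left right]:
  assumes "f \<in> sphere_ideal l" and "\<And>f. f \<in> sphere_relations l \<Longrightarrow> P f" and "P 0"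
    and "\<And>f g. P f \<Longrightarrow> P g \<Longrightarrow> P (f + g)"
    and "\<And>f h. P f \<Longrightarrow> P (h * f)" and "\<And>f h. P f \<Longrightarrow> P (f * h)"
  shows "P f"
proof -
  have "ideal (Collect P) free_ring"
    by (rule ideal_free_ringI) (use assms in auto)
  then have "sphere_ideal l \<subseteq> Collect P"
    unfolding sphere_ideal_def
    by (rule ring.genideal_minimal[OF ring_free_ring]) (use assms(2) in auto)
  then show ?thesis using assms(1) by auto
qed

lemma sphere_ideal_0: "0 \<in> sphere_ideal l"
  using additive_subgroup.zero_closed[OF ideal.axioms(1)[OF ideal_sphere_ideal]] by simp

lemma sphere_ideal_add: "f \<in> sphere_ideal l \<Longrightarrow> g \<in> sphere_ideal l \<Longrightarrow> f + g \<in> sphere_ideal l"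
  using additive_subgroup.a_closed[OF ideal.axioms(1)[OF ideal_sphere_ideal]] by force

lemma sphere_ideal_mult_left: "f \<in> sphere_ideal l \<Longrightarrow> h * f \<in> sphere_ideal l"
  using ideal.I_l_closed[OF ideal_sphere_ideal] by force

lemma sphere_ideal_mult_right: "f \<in> sphere_ideal l \<Longrightarrow> f * h \<in> sphere_ideal l"
  using ideal.I_r_closed[OF ideal_sphere_ideal] by force

lemma sphere_ideal_minus: "f \<in> sphere_ideal l \<Longrightarrow> - f \<in> sphere_ideal l"
  using sphere_ideal_mult_left[of f l "-1"] by simp

text \<open>A common form for \<open>coord\<close> and \<open>scalar\<close>: every element of the
  quotient gets a free representative, and identities in the quotient become membership of a
  difference in the ideal.\<close>

definition cls :: "real \<Rightarrow> free_alg \<Rightarrow> free_alg set" where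
  "cls l f = sphere_ideal l +>\<^bsub>free_ring\<^esub> f"

lemma cls_alt: "cls l f = (\<lambda>h. h + f) ` sphere_ideal l"
  by (auto simp: cls_def a_r_coset_def')

lemma cls_eq_iff: "cls l f = cls l g \<longleftrightarrow> f - g \<in> sphere_ideal l"
proof
  assume "cls l f = cls l g"
  moreover have "f \<in> cls l f" using sphere_ideal_0 by (force simp: cls_alt)
  ultimately show "f - g \<in> sphere_ideal l" by (auto simp: cls_alt)
next
  have *: "cls l f \<subseteq> cls l g" if "f - g \<in> sphere_ideal l" for f g
  proof
    fix x assume "x \<in> cls l f"
    then obtain h where "h \<in> sphere_ideal l" "x = (h + (f - g)) + g" by (auto simp: cls_alt)
    then show "x \<in> cls l g" using that sphere_ideal_add unfolding cls_alt by blast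
  qed
  assume "f - g \<in> sphere_ideal l"
  then show "cls l f = cls l g" 
    using *[of f g] *[of g f] sphere_ideal_minus[of "f - g" l] by auto
qed

lemma carrier_fuzzy_sphere: "carrier (\<A> l) = range (cls l)"
  by (auto simp: fuzzy_sphere_def FactRing_def A_RCOSETS_def' cls_def)

lemma cls_carrier [simp]: "cls l f \<in> carrier (\<A> l)"
  by (simp add: carrier_fuzzy_sphere)

lemma ring_fuzzy_sphere: "ring (\<A> l)"
  unfolding fuzzy_sphere_def by (rule ideal.quotient_is_ring[OF ideal_sphere_ideal])

lemma cls_hom: "cls l \<in> ring_hom free_ring (\<A> l)"
  using ideal.rcos_ring_hom[OF ideal_sphere_ideal] by (simp add: fuzzy_sphere_def cls_def[abs_def])

lemma cls_mult [simp]: "cls l f \<otimes>\<^bsub>\<A> l\<^esub> cls l g = cls l (f * g)"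
  using ring_hom_mult[OF cls_hom, of f g] by simp

lemma cls_add [simp]: "cls l f \<oplus>\<^bsub>\<A> l\<^esub> cls l g = cls l (f + g)"
  using ring_hom_add[OF cls_hom, of f g] by simp

lemma one_fuzzy_sphere: "\<one>\<^bsub>\<A> l\<^esub> = cls l 1"
  using ring_hom_one[OF cls_hom] by simp

lemma zero_fuzzy_sphere: "\<zero>\<^bsub>\<A> l\<^esub> = cls l 0"
  using sphere_ideal_0 by (auto simp: fuzzy_sphere_def FactRing_def cls_alt)

lemma cls_minus [simp]: "cls l f \<ominus>\<^bsub>\<A> l\<^esub> cls l g = cls l (f - g)"
proof -
  interpret ring "\<A> l" by (rule ring_fuzzy_sphere)
  have "\<ominus>\<^bsub>\<A> l\<^esub> cls l g = cls l (- g)"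
    by (rule minus_equality) (auto simp: zero_fuzzy_sphere)
  then show ?thesis by (simp add: minus_eq)
qed

lemma cls_finsum [simp]: "finite S \<Longrightarrow> (\<Oplus>\<^bsub>\<A> l\<^esub>i\<in>S. cls l (f i)) = cls l (sum f S)"
proof (induction S rule: finite_induct)
  case empty
  interpret ring "\<A> l" by (rule ring_fuzzy_sphere)
  show ?case by (simp add: zero_fuzzy_sphere)
next
  case (insert x F)
  interpret ring "\<A> l" by (rule ring_fuzzy_sphere)
  show ?case using insert by (simp add: finsum_insert)
qed

lemma coord_cls: "coord l i = cls l (free_gen i)"
  by (simp add: coord_def cls_def)

lemma scalar_cls: "scalar l c = cls l (free_const c)"
  by (simp add: scalar_def cls_def)

lemma commutator_relation:
  "cls l (free_gen i * free_gen j) =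
     cls l (free_gen j * free_gen i + (\<Sum>k\<in>UNIV. free_const (2 * \<i> * of_real l * of_real (eps i j k)) * free_gen k))"
proof -
  have "free_gen i * free_gen j - free_gen j * free_gen i
      - (\<Sum>k\<in>UNIV. free_const (2 * \<i> * of_real l * of_real (eps i j k)) * free_gen k) \<in> sphere_relations l"
    unfolding sphere_relations_def by blast
  then show ?thesis
    unfolding cls_eq_iff using sphere_relations_subset[of l] by (auto simp: diff_diff_eq)
qed

lemma radius_relation: "cls l (\<Sum>i\<in>UNIV. free_gen i * free_gen i) = cls l (free_const (1 - (of_real l)\<^sup>2))"
  unfolding cls_eq_iff using sphere_relations_subset[of l] by (auto simp: sphere_relations_def)

text \<open>The star negates a commutator of self-adjoint generators and also the imaginary
  structure constants, so it maps a commutator relation to its negative; it fixes the radius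
  relation.\<close>

lemma free_star_sphere_ideal: "f \<in> sphere_ideal l \<Longrightarrow> free_star f \<in> sphere_ideal l"
proof (induction rule: sphere_ideal_induct)
  case (relation f)
  then consider (comm) i j where "f = free_gen i * free_gen j - free_gen j * free_gen i
        - (\<Sum>k\<in>UNIV. free_const (2 * \<i> * of_real l * of_real (eps i j k)) * free_gen k)"
    | (radius) "f = (\<Sum>i\<in>UNIV. free_gen i * free_gen i) - free_const (1 - (of_real l)\<^sup>2)"
    unfolding sphere_relations_def by auto
  then show ?case
  proof cases
    case comm
    have "free_star f = - f"
      unfolding comm by (simp add: free_star_diff free_star_mult free_star_sum free_const_central free_const_minus sum_negf)
    then show ?thesis using relation sphere_relations_subset sphere_ideal_minus by auto
  next
    case radius
    have "free_star f = f"
      unfolding radius by (simp add: free_star_diff free_star_mult free_star_sum)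
    then show ?thesis using relation sphere_relations_subset by auto
  qed
qed (auto simp: free_star_add free_star_mult sphere_ideal_0 sphere_ideal_add sphere_ideal_mult_left sphere_ideal_mult_right)

lemma star_cls [simp]: "star (cls l f) = cls l (free_star f)"
proof -
  \<comment> \<open>Stability gives one inclusion; involutivity of the star gives the other.\<close>
  have *: "free_star ` sphere_ideal l = sphere_ideal l"
    using free_star_sphere_ideal by (force intro: image_eqI[of _ _ "free_star x" for x])
  have "star (cls l f) = (\<lambda>h. h + free_star f) ` free_star ` sphere_ideal l"
    by (simp add: star_def cls_alt image_image free_star_add)
  then show ?thesis by (simp add: * cls_alt)
qed

section \<open>The fuzzy sphere is nontrivial\<close>

text \<open>
  The generators act through the Verma module of \<open>sl\<^sub>2\<close> whose highest weight
  \<open>\<mu> = 1/\<lambda>\<^sub>p - 1\<close> is chosen such that the Casimir element \<open>\<lambda>\<^sub>p\<^sup>2 \<mu> (\<mu> + 2)\<close> equals \<open>1 - \<lambda>\<^sub>p\<^sup>2\<close>.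
\<close>

definition verma_raise :: "complex \<Rightarrow> (nat \<Rightarrow> complex) \<Rightarrow> nat \<Rightarrow> complex" where
  "verma_raise \<mu> v n = (of_nat n + 1) * (\<mu> - of_nat n) * v (Suc n)"

definition verma_lower :: "(nat \<Rightarrow> complex) \<Rightarrow> nat \<Rightarrow> complex" where
  "verma_lower v n = (case n of 0 \<Rightarrow> 0 | Suc m \<Rightarrow> v m)"

text \<open>A vector is its family of coefficients on the weight basis, with arbitrary support.
  Writing \<open>E\<close>, \<open>F\<close> for raising and lowering and \<open>H\<close> for the
  weight operator, the generators act as \<open>x_1 = l (E + F)\<close>,
  \<open>x_2 = - i l (E - F)\<close> and \<open>x_3 = l H\<close>.\<close>

definition verma_gen :: "real \<Rightarrow> 3 \<Rightarrow> (nat \<Rightarrow> complex) \<Rightarrow> nat \<Rightarrow> complex" where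
  "verma_gen l i v n = (let \<mu> = 1 / of_real l - 1 in of_real l *
     (if i = 1 then verma_raise \<mu> v n + verma_lower v n
      else if i = 2 then - \<i> * (verma_raise \<mu> v n - verma_lower v n)
      else (\<mu> - 2 * of_nat n) * v n))"

definition verma_word :: "real \<Rightarrow> word \<Rightarrow> (nat \<Rightarrow> complex) \<Rightarrow> nat \<Rightarrow> complex" where
  "verma_word l w = foldr (verma_gen l) (letters w)"

definition verma_act :: "real \<Rightarrow> free_alg \<Rightarrow> (nat \<Rightarrow> complex) \<Rightarrow> nat \<Rightarrow> complex" where
  "verma_act l f v n = (\<Sum>w\<in>Poly_Mapping.keys f. Poly_Mapping.lookup f w * verma_word l w v n)"

lemma verma_gen_linear:
  "verma_gen l i (\<lambda>n. a * u n + b * v n) = (\<lambda>n. a * verma_gen l i u n + b * verma_gen l i v n)"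
  by (rule ext)
     (auto simp: verma_gen_def verma_raise_def verma_lower_def Let_def algebra_simps split: nat.splits)

lemma verma_word_linear:
  "verma_word l w (\<lambda>n. a * u n + b * v n) = (\<lambda>n. a * verma_word l w u n + b * verma_word l w v n)"
proof -
  have "foldr (verma_gen l) is (\<lambda>n. a * u n + b * v n)
     = (\<lambda>n. a * foldr (verma_gen l) is u n + b * foldr (verma_gen l) is v n)" for "is"
    by (induction "is") (simp_all add: verma_gen_linear)
  then show ?thesis by (simp add: verma_word_def)
qed

lemma verma_word_add: "verma_word l (w + w') v = verma_word l w (verma_word l w' v)"
  by (simp add: verma_word_def word_add_letters)

text \<open>Allows several elements to be summed over one common index set, although their supports
  differ.\<close>

lemma verma_act_superset:
  assumes "finite S" "Poly_Mapping.keys f \<subseteq> S"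
  shows "verma_act l f v n = (\<Sum>w\<in>S. Poly_Mapping.lookup f w * verma_word l w v n)"
  unfolding verma_act_def by (rule sum.mono_neutral_left) (use assms in \<open>auto simp: in_keys_iff\<close>)

lemma verma_act_single: "verma_act l (Poly_Mapping.single w c) v n = c * verma_word l w v n"
  by (subst verma_act_superset[of "{w}"]) auto

lemma verma_act_add: "verma_act l (f + g) v n = verma_act l f v n + verma_act l g v n"
proof -
  let ?S = "Poly_Mapping.keys f \<union> Poly_Mapping.keys g"
  have "verma_act l h v n = (\<Sum>w\<in>?S. Poly_Mapping.lookup h w * verma_word l w v n)"
    if "Poly_Mapping.keys h \<subseteq> ?S" for h
    using that by (intro verma_act_superset) auto
  from this[of f] this[of g] this[of "f + g"] show ?thesis
    by (simp add: keys_add lookup_add sum.distrib algebra_simps)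
qed

lemma verma_act_0 [simp]: "verma_act l 0 v n = 0"
  by (simp add: verma_act_def)

lemma verma_act_diff: "verma_act l (f - g) v n = verma_act l f v n - verma_act l g v n"
  using verma_act_add[of l "f - g" g v n] by simp

lemma verma_act_sum: "verma_act l (sum f S) v n = (\<Sum>i\<in>S. verma_act l (f i) v n)"
  by (induction S rule: infinite_finite_induct) (auto simp: verma_act_add)

lemma verma_act_linear:
  "verma_act l f (\<lambda>n. a * u n + b * v n) n = a * verma_act l f u n + b * verma_act l f v n"
  by (simp add: verma_act_def verma_word_linear sum.distrib sum_distrib_left algebra_simps)

text \<open>Linearity reduces both factors to monomials, where concatenation of words is composition
  of operators.\<close>

lemma verma_act_mult: "verma_act l (f * g) v = verma_act l f (verma_act l g v)"
proof (induction f rule: poly_mapping_single_induct)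
  case (single w c)
  show ?case
  proof (induction g rule: poly_mapping_single_induct)
    case (single w' c')
    \<comment> \<open>The zero summand gives the shape of a linear combination that
      \<open>verma_word_linear\<close> expects.\<close>
    have "verma_act l (Poly_Mapping.single w' c') v = (\<lambda>n. c' * verma_word l w' v n + 0 * v n)"
      by (rule ext) (simp add: verma_act_single)
    then show ?case
      by (intro ext) (simp only: mult_single verma_act_single verma_word_add verma_word_linear, simp)
  next
    case (add f g)
    have "verma_act l (f + g) v = (\<lambda>n. 1 * verma_act l f v n + 1 * verma_act l g v n)"
      by (rule ext) (simp add: verma_act_add)
    then have *: "verma_act l (Poly_Mapping.single w c) (verma_act l (f + g) v) n
      = 1 * verma_act l (Poly_Mapping.single w c) (verma_act l f v) n
        + 1 * verma_act l (Poly_Mapping.single w c) (verma_act l g v) n" for n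
      by (simp only: verma_act_linear)
    show ?case
      by (rule ext, subst *) (simp add: add distrib_left verma_act_add)
  qed
qed (auto simp: distrib_right verma_act_add)

lemma verma_act_gen: "verma_act l (free_gen i) v = verma_gen l i v"
  by (rule ext) (simp add: free_gen_def verma_act_single verma_word_def)

lemma verma_act_const: "verma_act l (free_const c) v = (\<lambda>n. c * v n)"
  by (rule ext) (simp add: free_const_def verma_act_single verma_word_def zero_word_def)

text \<open>These are the relations \<open>[E, F] = H\<close>, \<open>[H, E] = 2 E\<close> and
  \<open>[H, F] = - 2 F\<close> in terms of the generators. The index \<open>n = 0\<close> is split
  off because \<open>verma_lower\<close> vanishes there.\<close>

lemma verma_gen_commutator:
  "verma_gen l i (verma_gen l j v) n - verma_gen l j (verma_gen l i v) n
    = (\<Sum>k\<in>UNIV. 2 * \<i> * of_real l * of_real (eps i j k) * verma_gen l k v n)"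
proof -
  define \<mu> :: complex where "\<mu> = 1 / of_real l - 1"
  have simps: "verma_gen l 1 v n = of_real l * (verma_raise \<mu> v n + verma_lower v n)"
    "verma_gen l 2 v n = - \<i> * (of_real l * (verma_raise \<mu> v n - verma_lower v n))"
    "verma_gen l 3 v n = of_real l * ((\<mu> - 2 * of_nat n) * v n)" for v n
    by (simp_all add: verma_gen_def \<mu>_def Let_def)
  show ?thesis
    using exhaust_3[of i] exhaust_3[of j]
    by (elim disjE; cases n; simp add: sum_3 simps verma_raise_def verma_lower_def)
       (simp_all add: algebra_simps)
qed

text \<open>The sum of squares is \<open>l^2 (2 E F + 2 F E + H^2)\<close>, which acts on the whole
  module by the scalar \<open>l^2 mu (mu + 2)\<close>.\<close>

lemma verma_gen_radius:
  assumes "l \<noteq> 0"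
  shows "(\<Sum>i\<in>UNIV. verma_gen l i (verma_gen l i v) n) = (1 - (of_real l)\<^sup>2) * v n"
proof -
  define \<mu> :: complex where "\<mu> = 1 / of_real l - 1"
  have simps: "verma_gen l 1 v n = of_real l * (verma_raise \<mu> v n + verma_lower v n)"
    "verma_gen l 2 v n = - \<i> * (of_real l * (verma_raise \<mu> v n - verma_lower v n))"
    "verma_gen l 3 v n = of_real l * ((\<mu> - 2 * of_nat n) * v n)" for v n
    by (simp_all add: verma_gen_def \<mu>_def Let_def)
  have "(\<Sum>i\<in>UNIV. verma_gen l i (verma_gen l i v) n) = (of_real l)\<^sup>2 * (\<mu> * (\<mu> + 2)) * v n"
    by (cases n; simp add: sum_3 simps verma_raise_def verma_lower_def)
       (simp_all add: algebra_simps power2_eq_square)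
  also have "(of_real l)\<^sup>2 * (\<mu> * (\<mu> + 2)) = 1 - (of_real l :: complex)\<^sup>2"
    using assms by (simp add: \<mu>_def field_simps power2_eq_square)
  finally show ?thesis .
qed

lemma verma_act_sphere_ideal:
  assumes "l \<noteq> 0" "f \<in> sphere_ideal l"
  shows "verma_act l f v n = 0"
proof -
  \<comment> \<open>The vector is quantified inside the induction because a right multiple
    \<open>f * h\<close> applies \<open>f\<close> to the new vector \<open>h v\<close>.\<close>
  have "\<forall>v. verma_act l f v = (\<lambda>_. 0)"
    using assms(2)
  proof (induction rule: sphere_ideal_induct)
    case (relation f)
    then consider (comm) i j where "f = free_gen i * free_gen j - free_gen j * free_gen i
          - (\<Sum>k\<in>UNIV. free_const (2 * \<i> * of_real l * of_real (eps i j k)) * free_gen k)"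
      | (radius) "f = (\<Sum>i\<in>UNIV. free_gen i * free_gen i) - free_const (1 - (of_real l)\<^sup>2)"
      unfolding sphere_relations_def by auto
    then show ?case
    proof cases
      case comm
      have "verma_act l f v n = verma_gen l i (verma_gen l j v) n - verma_gen l j (verma_gen l i v) n
          - (\<Sum>k\<in>UNIV. 2 * \<i> * of_real l * of_real (eps i j k) * verma_gen l k v n)" for v n
        by (simp only: comm verma_act_diff verma_act_sum verma_act_mult verma_act_gen verma_act_const)
      then show ?thesis by (simp add: verma_gen_commutator fun_eq_iff)
    next
      case radius
      have "verma_act l f v n = (\<Sum>i\<in>UNIV. verma_gen l i (verma_gen l i v) n)
          - (1 - (of_real l)\<^sup>2) * v n" for v n
        by (simp only: radius verma_act_diff verma_act_sum verma_act_mult verma_act_gen verma_act_const)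
      then show ?thesis by (simp add: verma_gen_radius[OF assms(1)] fun_eq_iff)
    qed
  next
    case (left f h)
    have "verma_act l h (\<lambda>_. 0) n = 0" for n
      using verma_act_linear[of l h 0 "\<lambda>_. 0" 0 "\<lambda>_. 0" n] by simp
    then show ?case using left by (auto simp: verma_act_mult)
  qed (auto simp: verma_act_add verma_act_mult fun_eq_iff)
  then show ?thesis by simp
qed

text \<open>On the vector with all coefficients \<open>1\<close> a constant acts as itself, so only
  zero can annihilate it. This turns equations between scalar classes into equations between complex
  numbers.\<close>

lemma free_const_sphere_ideal: "l \<noteq> 0 \<Longrightarrow> free_const c \<in> sphere_ideal l \<longleftrightarrow> c = 0"
  using verma_act_sphere_ideal[of l "free_const c" "\<lambda>_. 1"] sphere_ideal_0
  by (auto simp: verma_act_const)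

section \<open>The differential calculus is inner\<close>

lemma ball_fuzzy_sphere: "(\<forall>a\<in>carrier (\<A> l). P a) \<longleftrightarrow> (\<forall>f. P (cls l f))"
  by (simp add: carrier_fuzzy_sphere)

lemma Omega1_cls: "Omega1 l = range (\<lambda>w i. cls l (w i))"
proof (intro equalityI subsetI)
  fix \<omega> assume "\<omega> \<in> Omega1 l"
  then have "\<omega> = (\<lambda>i. cls l (inv_into UNIV (cls l) (\<omega> i)))"
    by (auto simp: Omega1_def carrier_fuzzy_sphere f_inv_into_f)
  then show "\<omega> \<in> range (\<lambda>w i. cls l (w i))"
    by (intro image_eqI[where x = "\<lambda>i. inv_into UNIV (cls l) (\<omega> i)"]) auto
qed (auto simp: Omega1_def)

lemma Omega11_cls: "Omega11 l = range (\<lambda>t i j. cls l (t i j))"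
proof (intro equalityI subsetI)
  fix T assume "T \<in> Omega11 l"
  then have "T = (\<lambda>i j. cls l (inv_into UNIV (cls l) (T i j)))"
    by (auto simp: Omega11_def carrier_fuzzy_sphere f_inv_into_f)
  then show "T \<in> range (\<lambda>t i j. cls l (t i j))"
    by (intro image_eqI[where x = "\<lambda>i j. inv_into UNIV (cls l) (T i j)"]) auto
qed (auto simp: Omega11_def)

lemma ball_Omega1: "(\<forall>\<omega>\<in>Omega1 l. P \<omega>) \<longleftrightarrow> (\<forall>w. P (\<lambda>i. cls l (w i)))"
  by (simp add: Omega1_cls)

lemma ball_Omega11: "(\<forall>T\<in>Omega11 l. P T) \<longleftrightarrow> (\<forall>t. P (\<lambda>i j. cls l (t i j)))"
  by (simp add: Omega11_cls)

lemma cls_Omega1 [simp]: "(\<lambda>i. cls l (w i)) \<in> Omega1 l"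
  by (simp add: Omega1_def)

lemma cls_Omega11 [simp]: "(\<lambda>i j. cls l (t i j)) \<in> Omega11 l"
  by (simp add: Omega11_def)

lemma sform_cls: "sform l i = (\<lambda>j. cls l (if j = i then 1 else 0))"
  by (rule ext) (simp add: sform_def one_fuzzy_sphere zero_fuzzy_sphere)

lemma eps_cyclic: "eps k i j = eps i j k"
  using exhaust_3[of i] exhaust_3[of j] exhaust_3[of k] by (elim disjE) simp_all

lemma eps_swap: "eps i k j = - eps i j k"
  using exhaust_3[of i] exhaust_3[of j] exhaust_3[of k] by (elim disjE) simp_all

text \<open>
  Since \<open>\<epsilon>\<^sub>i\<^sub>j\<^sub>k x\<^sub>j = [x\<^sub>k, x\<^sub>i] / (2 \<i> \<lambda>\<^sub>p)\<close>, the component of \<open>d\<close> along \<open>s\<^sup>k\<close> is an inner derivation.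
\<close>

definition free_d :: "real \<Rightarrow> 3 \<Rightarrow> free_alg \<Rightarrow> free_alg" where
  "free_d l k f = free_const (1 / (2 * \<i> * of_real l)) * (free_gen k * f - f * free_gen k)"

lemma free_d_add: "free_d l k (f + g) = free_d l k f + free_d l k g"
  by (simp add: free_d_def algebra_simps)

lemma free_d_mult: "free_d l k (f * g) = free_d l k f * g + f * free_d l k g"
proof -
  define K where "K = free_const (1 / (2 * \<i> * of_real l))"
  have "f * (K * h) = K * (f * h)" for h
    by (simp add: K_def free_const_left_commute)
  then show ?thesis
    unfolding free_d_def K_def[symmetric] by (simp add: algebra_simps)
qed

lemma free_d_const [simp]: "free_d l k (free_const c) = 0"
  by (simp add: free_d_def free_const_central)

lemma free_d_0 [simp]: "free_d l k 0 = 0"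
  using free_d_const[of l k 0] by simp

text \<open>Two signs cancel: the prefactor is imaginary, and the star reverses the commutator with
  a self-adjoint generator.\<close>

lemma free_d_star: "free_star (free_d l k f) = free_d l k (free_star f)"
proof -
  define K where "K = free_const (1 / (2 * \<i> * of_real l))"
  have "free_star K = - K"
    by (simp add: K_def free_const_minus)
  moreover have "h * K = K * h" for h
    by (simp add: K_def free_const_central)
  ultimately show ?thesis
    unfolding free_d_def K_def[symmetric] by (simp add: free_star_mult free_star_diff algebra_simps)
qed

text \<open>The commutator relation for \<open>x_k\<close> and \<open>x_i\<close>, divided by
  \<open>2 i l\<close>; cyclicity of \<open>eps\<close> brings the indices into the order of the
  prescribed differential.\<close>

lemma free_d_gen:
  assumes "l \<noteq> 0"
  shows "cls l (free_d l k (free_gen i)) = cls l (\<Sum>j\<in>UNIV. free_const (of_real (eps i j k)) * free_gen j)"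
proof -
  let ?c = "1 / (2 * \<i> * of_real l) :: complex"
  have "free_gen k * free_gen i - free_gen i * free_gen k
      - (\<Sum>j\<in>UNIV. free_const (2 * \<i> * of_real l * of_real (eps k i j)) * free_gen j) \<in> sphere_ideal l"
    using commutator_relation[of l k i] by (simp add: cls_eq_iff diff_diff_eq)
  then have "free_const ?c * (free_gen k * free_gen i - free_gen i * free_gen k
      - (\<Sum>j\<in>UNIV. free_const (2 * \<i> * of_real l * of_real (eps k i j)) * free_gen j)) \<in> sphere_ideal l"
    by (rule sphere_ideal_mult_left)
  also have "free_const ?c * (free_gen k * free_gen i - free_gen i * free_gen k
      - (\<Sum>j\<in>UNIV. free_const (2 * \<i> * of_real l * of_real (eps k i j)) * free_gen j))
      = free_d l k (free_gen i)
        - (\<Sum>j\<in>UNIV. free_const (?c * (2 * \<i> * of_real l * of_real (eps k i j))) * free_gen j)"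
    by (simp only: free_d_def free_const_mult right_diff_distrib sum_distrib_left mult.assoc)
  also have "(\<lambda>j. ?c * (2 * \<i> * of_real l * of_real (eps k i j))) = (\<lambda>j. of_real (eps i j k))"
    using assms by (simp add: eps_cyclic[of k i])
  finally show ?thesis
    unfolding cls_eq_iff by (metis (no_types, lifting))
qed

section \<open>Existence and uniqueness of the differential\<close>

lemma is_differential_inner:
  assumes "l \<noteq> 0"
  obtains D where "is_differential l D" and "\<And>f. D (cls l f) = (\<lambda>k. cls l (free_d l k f))"
proof
  \<comment> \<open>The inner derivation is formed with the operations of the quotient, so
    independence of representatives is automatic.\<close>
  define D where "D = (\<lambda>a\<in>carrier (\<A> l). \<lambda>k. scalar l (1 / (2 * \<i> * of_real l))
    \<otimes>\<^bsub>\<A> l\<^esub> (coord l k \<otimes>\<^bsub>\<A> l\<^esub> a \<ominus>\<^bsub>\<A> l\<^esub> a \<otimes>\<^bsub>\<A> l\<^esub> coord l k))"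
  show D: "D (cls l f) = (\<lambda>k. cls l (free_d l k f))" for f
    by (simp add: D_def coord_cls scalar_cls free_d_def)
  have "D \<in> carrier (\<A> l) \<rightarrow>\<^sub>E Omega1 l"
  proof (rule PiE_I)
    show "D a \<in> Omega1 l" if "a \<in> carrier (\<A> l)" for a
      using that unfolding carrier_fuzzy_sphere by (auto simp: D)
  qed (simp add: D_def)
  then show "is_differential l D"
    unfolding is_differential_def ball_fuzzy_sphere
    by (simp add: D add1_def lmult1_def rmult1_def scalar_cls coord_cls free_d_add free_d_mult
        free_d_gen[OF assms])
qed

lemma is_differential_unique:
  assumes "is_differential l D" "is_differential l D'"
  shows "D = D'"
proof (rule PiE_ext)
  show "D \<in> carrier (\<A> l) \<rightarrow>\<^sub>E Omega1 l" "D' \<in> carrier (\<A> l) \<rightarrow>\<^sub>E Omega1 l"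
    using assms by (auto simp: is_differential_def)
  \<comment> \<open>The Leibniz rule for \<open>1 * 1\<close> gives \<open>D 1 = D 1 + D 1\<close>,
    and linearity then kills all constants.\<close>
  have one: "D (cls l 1) = (\<lambda>k. cls l 0)" and D_const: "D (cls l (free_const c)) = (\<lambda>k. cls l 0)"
    if "is_differential l D" for D c
  proof -
    have "D (cls l 1) \<in> Omega1 l"
      using that by (force simp: is_differential_def)
    then obtain w where w: "D (cls l 1) = (\<lambda>k. cls l (w k))"
      by (auto simp: Omega1_cls)
    have "D (cls l 1 \<otimes>\<^bsub>\<A> l\<^esub> cls l 1) = add1 l (rmult1 l (D (cls l 1)) (cls l 1)) (lmult1 l (cls l 1) (D (cls l 1)))"
      using that cls_carrier unfolding is_differential_def by blast
    then have "cls l (w k) = cls l (w k + w k)" for k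
      by (simp add: w add1_def rmult1_def lmult1_def fun_eq_iff)
    then show one: "D (cls l 1) = (\<lambda>k. cls l 0)"
      using sphere_ideal_minus by (force simp: w cls_eq_iff fun_eq_iff)
    have "D (scalar l c \<otimes>\<^bsub>\<A> l\<^esub> cls l 1) = lmult1 l (scalar l c) (D (cls l 1))"
      using that cls_carrier unfolding is_differential_def by blast
    then show "D (cls l (free_const c)) = (\<lambda>k. cls l 0)"
      by (simp add: one lmult1_def scalar_cls)
  qed
  have "D (cls l f) = D' (cls l f)" for f
  proof (induction f rule: free_alg_induct)
    case (const c)
    then show ?case using D_const[OF assms(1)] D_const[OF assms(2)] by simp
  next
    case (gen i)
    then show ?case using assms by (simp add: is_differential_def coord_cls)
  next
    case (add f g)
    have "E (cls l f \<oplus>\<^bsub>\<A> l\<^esub> cls l g) = add1 l (E (cls l f)) (E (cls l g))" if "is_differential l E" for E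
      using that cls_carrier unfolding is_differential_def by blast
    from this[OF assms(1)] this[OF assms(2)] show ?case by (simp only: add cls_add)
  next
    case (mult f g)
    have "E (cls l f \<otimes>\<^bsub>\<A> l\<^esub> cls l g) = add1 l (rmult1 l (E (cls l f)) (cls l g)) (lmult1 l (cls l f) (E (cls l g)))"
      if "is_differential l E" for E
      using that cls_carrier unfolding is_differential_def by blast
    from this[OF assms(1)] this[OF assms(2)] show ?case by (simp only: mult cls_mult)
  qed
  then show "D a = D' a" if "a \<in> carrier (\<A> l)" for a
    using that by (auto simp: carrier_fuzzy_sphere)
qed

lemma dA_cls:
  assumes "l \<noteq> 0"
  shows "dA l (cls l f) = (\<lambda>k. cls l (free_d l k f))"
proof -
  obtain D where "is_differential l D" and D: "\<And>f. D (cls l f) = (\<lambda>k. cls l (free_d l k f))"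
    using is_differential_inner[OF assms] by blast
  then have "dA l = D"
    unfolding dA_def using is_differential_unique by blast
  then show ?thesis using D by simp
qed

text \<open>
  The differentials \<open>d x\<^sub>i\<close> generate the one-forms, because
  \<open>(1 - \<lambda>\<^sub>p\<^sup>2) s\<^sup>a = x\<^sub>a \<theta> + 2 \<i> \<lambda>\<^sub>p d x\<^sub>a - \<epsilon>\<^sub>a\<^sub>b\<^sub>i x\<^sub>b d x\<^sub>i\<close> with
  \<open>\<theta> = x\<^sub>k s\<^sup>k = x\<^sub>i d x\<^sub>i / (2 \<i> \<lambda>\<^sub>p)\<close>.
\<close>

definition gen_coeff :: "real \<Rightarrow> 3 \<Rightarrow> 3 \<Rightarrow> free_alg" where
  "gen_coeff l a i = free_const (1 / (1 - (of_real l)\<^sup>2)) *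
     (free_const (1 / (2 * \<i> * of_real l)) * (free_gen a * free_gen i)
      + (if i = a then free_const (2 * \<i> * of_real l) else 0)
      - (\<Sum>b\<in>UNIV. free_const (of_real (eps a b i)) * free_gen b))"

lemma cls_cong_add: "cls l f = cls l f' \<Longrightarrow> cls l g = cls l g' \<Longrightarrow> cls l (f + g) = cls l (f' + g')"
  by (metis cls_add)

lemma cls_cong_diff: "cls l f = cls l f' \<Longrightarrow> cls l g = cls l g' \<Longrightarrow> cls l (f - g) = cls l (f' - g')"
  by (metis cls_minus)

lemma cls_cong_mult: "cls l f = cls l f' \<Longrightarrow> cls l g = cls l g' \<Longrightarrow> cls l (f * g) = cls l (f' * g')"
  by (metis cls_mult)

lemma cls_cong_sum: "(\<And>i. i \<in> S \<Longrightarrow> cls l (f i) = cls l (g i)) \<Longrightarrow> cls l (sum f S) = cls l (sum g S)"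
proof (induction S rule: infinite_finite_induct)
  case (insert x S)
  then have "cls l (f x + sum f S) = cls l (g x + sum g S)"
    by (intro cls_cong_add) auto
  with insert.hyps show ?case by simp
qed simp_all

text \<open>Contracting \<open>eps\<close> with \<open>x_i x_j\<close> leaves a single commutator,
  which the defining relation evaluates.\<close>

lemma sum_gen_d_gen:
  assumes "l \<noteq> 0"
  shows "cls l (\<Sum>i\<in>UNIV. free_gen i * free_d l k (free_gen i)) = cls l (free_const (2 * \<i> * of_real l) * free_gen k)"
proof -
  have "cls l (\<Sum>i\<in>UNIV. free_gen i * free_d l k (free_gen i))
      = cls l (\<Sum>i\<in>UNIV. free_gen i * (\<Sum>j\<in>UNIV. free_const (of_real (eps i j k)) * free_gen j))"
    by (intro cls_cong_sum cls_cong_mult free_d_gen assms refl)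
  also have "\<dots> = cls l (free_const (2 * \<i> * of_real l) * free_gen k)"
    unfolding cls_eq_iff
    using exhaust_3[of k] commutator_relation[of l 1 2] commutator_relation[of l 2 3] commutator_relation[of l 3 1]
    by (elim disjE) (simp_all add: sum_3 cls_eq_iff free_const_minus algebra_simps)
  finally show ?thesis .
qed

text \<open>After inserting \<open>d x_i\<close>, this is the contraction of two \<open>eps\<close>
  symbols over one index into a difference of products of Kronecker deltas.\<close>

lemma sum_eps_gen_d_gen:
  assumes "l \<noteq> 0"
  shows "cls l (\<Sum>i\<in>UNIV. (\<Sum>b\<in>UNIV. free_const (of_real (eps a b i)) * free_gen b) * free_d l k (free_gen i))
    = cls l (free_gen k * free_gen a - (if k = a then \<Sum>b\<in>UNIV. free_gen b * free_gen b else 0))"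
proof -
  have "cls l (\<Sum>i\<in>UNIV. (\<Sum>b\<in>UNIV. free_const (of_real (eps a b i)) * free_gen b) * free_d l k (free_gen i))
      = cls l (\<Sum>i\<in>UNIV. (\<Sum>b\<in>UNIV. free_const (of_real (eps a b i)) * free_gen b)
          * (\<Sum>j\<in>UNIV. free_const (of_real (eps i j k)) * free_gen j))"
    by (intro cls_cong_sum cls_cong_mult free_d_gen assms refl)
  also have "(\<Sum>i\<in>UNIV. (\<Sum>b\<in>UNIV. free_const (of_real (eps a b i)) * free_gen b)
          * (\<Sum>j\<in>UNIV. free_const (of_real (eps i j k)) * free_gen j))
      = free_gen k * free_gen a - (if k = a then \<Sum>b\<in>UNIV. free_gen b * free_gen b else 0)"
    using exhaust_3[of k] exhaust_3[of a]
    by (elim disjE) (simp_all add: sum_3 free_const_minus)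
  finally show ?thesis .
qed

text \<open>The terms \<open>x_a x_k\<close>, \<open>[x_k, x_a]\<close> and \<open>- x_k x_a\<close>
  cancel. The surviving diagonal term is the sum of squares, a scalar that is invertible because
  \<open>l\<close> is not \<open>1\<close> or \<open>-1\<close>.\<close>

lemma sum_gen_coeff:
  assumes "l \<noteq> 0" "l \<noteq> 1" "l \<noteq> - 1"
  shows "cls l (\<Sum>i\<in>UNIV. gen_coeff l a i * free_d l k (free_gen i)) = cls l (if k = a then 1 else 0)"
proof -
  let ?r = "free_const (1 / (1 - (of_real l)\<^sup>2))" and ?c = "free_const (1 / (2 * \<i> * of_real l))"
    and ?c' = "free_const (2 * \<i> * of_real l)"
  have l: "(of_real l)\<^sup>2 \<noteq> (1 :: complex)"
    using assms by (metis of_real_1 of_real_eq_iff of_real_power power2_eq_1_iff)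
  have cc: "?c' * ?c = 1" "?c * ?c' = 1"
    using assms(1) by (simp_all add: free_const_mult[symmetric])
  have "(\<Sum>i\<in>UNIV. gen_coeff l a i * free_d l k (free_gen i))
      = ?r * (?c * (free_gen a * (\<Sum>i\<in>UNIV. free_gen i * free_d l k (free_gen i)))
        + ?c' * free_d l k (free_gen a)
        - (\<Sum>i\<in>UNIV. (\<Sum>b\<in>UNIV. free_const (of_real (eps a b i)) * free_gen b) * free_d l k (free_gen i)))"
  proof -
    have "gen_coeff l a i * free_d l k (free_gen i)
        = ?r * (?c * (free_gen a * (free_gen i * free_d l k (free_gen i)))
          + (if i = a then ?c' * free_d l k (free_gen i) else 0)
          - (\<Sum>b\<in>UNIV. free_const (of_real (eps a b i)) * free_gen b) * free_d l k (free_gen i))" for i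
      unfolding gen_coeff_def by (cases "i = a") (simp_all only: ring_distribs mult.assoc if_True if_False simp_thms mult_zero_left)
    then show ?thesis
      by (simp only: sum_distrib_left[symmetric] sum_subtractf sum.distrib sum.delta finite_class.finite_UNIV UNIV_I if_True)
  qed
  also have "cls l \<dots> = cls l (?r * (?c * (free_gen a * (?c' * free_gen k))
        + ?c' * free_d l k (free_gen a)
        - (free_gen k * free_gen a - (if k = a then \<Sum>b\<in>UNIV. free_gen b * free_gen b else 0))))"
    by (intro cls_cong_mult cls_cong_add cls_cong_diff refl sum_gen_d_gen sum_eps_gen_d_gen assms)
  also have "?r * (?c * (free_gen a * (?c' * free_gen k)) + ?c' * free_d l k (free_gen a)
        - (free_gen k * free_gen a - (if k = a then \<Sum>b\<in>UNIV. free_gen b * free_gen b else 0)))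
      = ?r * (if k = a then \<Sum>b\<in>UNIV. free_gen b * free_gen b else 0)"
  proof -
    have "?c * (free_gen a * (?c' * free_gen k)) = free_gen a * free_gen k"
      by (subst free_const_left_commute) (simp only: mult.assoc[symmetric] cc mult_1)
    moreover have "?c' * free_d l k (free_gen a) = free_gen k * free_gen a - free_gen a * free_gen k"
      by (simp only: free_d_def mult.assoc[symmetric] cc mult_1)
    ultimately show ?thesis by simp
  qed
  also have "cls l \<dots> = cls l (?r * (if k = a then free_const (1 - (of_real l)\<^sup>2) else 0))"
    by (intro cls_cong_mult refl) (simp add: radius_relation)
  also have "?r * (if k = a then free_const (1 - (of_real l)\<^sup>2) else 0) = (if k = a then 1 else 0)"
    using l by (simp add: free_const_mult[symmetric])
  finally show ?thesis .
qed

section \<open>Connections with constant coefficients\<close>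

text \<open>The extension of the values on the basis forced by the left Leibniz rule;
  \<open>d w_q\<close> tensored with \<open>s^q\<close> contributes its component \<open>p\<close>
  at the entry \<open>p q\<close>.\<close>

definition const_connection :: "real \<Rightarrow> (3 \<Rightarrow> 3 \<Rightarrow> 3 \<Rightarrow> complex) \<Rightarrow> form1 \<Rightarrow> tensor2" where
  "const_connection l \<Gamma> = (\<lambda>\<omega>\<in>Omega1 l. \<lambda>p q. dA l (\<omega> q) p
     \<oplus>\<^bsub>\<A> l\<^esub> (\<Oplus>\<^bsub>\<A> l\<^esub>i\<in>UNIV. \<omega> i \<otimes>\<^bsub>\<A> l\<^esub> scalar l (- 1 / 2 * \<Gamma> i p q)))"

definition tensor_flip :: "real \<Rightarrow> tensor2 \<Rightarrow> tensor2" where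
  "tensor_flip l = (\<lambda>T\<in>Omega11 l. \<lambda>p q. T q p)"

lemma tensor_flip_cls [simp]: "tensor_flip l (\<lambda>i j. cls l (t i j)) = (\<lambda>i j. cls l (t j i))"
  by (simp add: tensor_flip_def)

lemma const_connection_cls:
  assumes "l \<noteq> 0"
  shows "const_connection l \<Gamma> (\<lambda>i. cls l (w i)) =
    (\<lambda>p q. cls l (free_d l p (w q) + (\<Sum>i\<in>UNIV. w i * free_const (- 1 / 2 * \<Gamma> i p q))))"
  by (simp add: const_connection_def dA_cls[OF assms] scalar_cls)

lemma const_connection_smult_sform:
  assumes "l \<noteq> 0"
  shows "const_connection l \<Gamma> (lmult1 l (scalar l c) (sform l i)) =
    (\<lambda>p q. cls l (free_const (- 1 / 2 * c * \<Gamma> i p q)))"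
proof -
  have "free_d l p (free_const c * (if q = i then 1 else 0)) = 0" for p q
    by simp
  moreover have "(\<Sum>m\<in>UNIV. free_const c * (if m = i then 1 else 0) * free_const (- 1 / 2 * \<Gamma> m p q))
      = free_const (- 1 / 2 * c * \<Gamma> i p q)" for p q
  proof -
    have "(\<Sum>m\<in>UNIV. free_const c * (if m = i then 1 else 0) * free_const (- 1 / 2 * \<Gamma> m p q))
        = (\<Sum>m\<in>UNIV. if m = i then free_const c * free_const (- 1 / 2 * \<Gamma> m p q) else 0)"
      by (intro sum.cong) auto
    also have "\<dots> = free_const c * free_const (- 1 / 2 * \<Gamma> i p q)"
      by simp
    finally show ?thesis
      by (simp add: free_const_mult[symmetric] mult.assoc mult.left_commute)
  qed
  ultimately show ?thesis
    by (simp only: sform_cls lmult1_def scalar_cls cls_mult const_connection_cls[OF assms] add_0)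
qed

lemma const_connection_sform:
  assumes "l \<noteq> 0"
  shows "const_connection l \<Gamma> (sform l i) = (\<lambda>p q. cls l (free_const (- 1 / 2 * \<Gamma> i p q)))"
proof -
  have "lmult1 l (scalar l 1) (sform l i) = sform l i"
    by (simp add: lmult1_def scalar_cls sform_cls)
  then show ?thesis
    using const_connection_smult_sform[OF assms, of \<Gamma> 1 i] by simp
qed

lemma has_coefficients_const_connection: "l \<noteq> 0 \<Longrightarrow> has_coefficients l (const_connection l \<Gamma>) \<Gamma>"
  by (simp add: has_coefficients_def const_connection_sform scalar_cls)

lemma left_connection_const_connection:
  assumes "l \<noteq> 0"
  shows "left_connection l (const_connection l \<Gamma>)"
proof -
  have closed: "const_connection l \<Gamma> \<in> Omega1 l \<rightarrow>\<^sub>E Omega11 l"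
  proof (rule PiE_I)
    show "const_connection l \<Gamma> \<omega> \<in> Omega11 l" if "\<omega> \<in> Omega1 l" for \<omega>
      using that unfolding Omega1_cls by (auto simp: const_connection_cls[OF assms])
  qed (simp add: const_connection_def)
  have add: "free_d l p (f + h) + (\<Sum>i\<in>UNIV. (u i + v i) * free_const (c i))
      = free_d l p f + (\<Sum>i\<in>UNIV. u i * free_const (c i))
        + (free_d l p h + (\<Sum>i\<in>UNIV. v i * free_const (c i)))" for p f h c and u v :: "3 \<Rightarrow> free_alg"
    by (simp add: free_d_add distrib_right sum.distrib)
  have leibniz: "free_d l p (a * f) + (\<Sum>i\<in>UNIV. a * w i * free_const (c i))
      = free_d l p a * f + a * (free_d l p f + (\<Sum>i\<in>UNIV. w i * free_const (c i)))"
    for p f a c and w :: "3 \<Rightarrow> free_alg"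
    by (simp add: free_d_mult distrib_left sum_distrib_left mult.assoc)
  show ?thesis
    unfolding left_connection_def ball_Omega1 ball_fuzzy_sphere
    by (intro conjI allI closed)
       (simp_all only: add1_def add2_def lmult1_def lmult2_def tensor_def const_connection_cls[OF assms]
        dA_cls[OF assms] scalar_cls cls_add cls_mult add leibniz free_d_const mult_zero_left add_0)
qed

text \<open>A one-form is a left combination of the \<open>s^i\<close>, so additivity and the
  Leibniz rule determine a left connection from its values on the basis.\<close>

lemma const_connection_unique:
  assumes "l \<noteq> 0" and nabla: "left_connection l nabla" and coeff: "has_coefficients l nabla \<Gamma>"
  shows "nabla = const_connection l \<Gamma>"
proof -
  have add: "conn (add1 l \<omega> \<eta>) = add2 l (conn \<omega>) (conn \<eta>)"
    if "left_connection l conn" "\<omega> \<in> Omega1 l" "\<eta> \<in> Omega1 l" for conn \<omega> \<eta>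
    using that unfolding left_connection_def by blast
  have leibniz: "conn (lmult1 l a \<omega>) = add2 l (tensor l (dA l a) \<omega>) (lmult2 l a (conn \<omega>))"
    if "left_connection l conn" "a \<in> carrier (\<A> l)" "\<omega> \<in> Omega1 l" for conn a \<omega>
    using that unfolding left_connection_def by blast
  have closed: "sform l i \<in> Omega1 l" "lmult1 l (cls l f) (sform l i) \<in> Omega1 l" for i f
    by (simp_all add: sform_cls lmult1_def)
  have closed_add: "add1 l \<omega> \<eta> \<in> Omega1 l" if "\<omega> \<in> Omega1 l" "\<eta> \<in> Omega1 l" for \<omega> \<eta>
    using that unfolding Omega1_cls by (auto simp: add1_def)
  have sform: "nabla (sform l i) = const_connection l \<Gamma> (sform l i)" for i
    using coeff has_coefficients_const_connection[OF assms(1)] unfolding has_coefficients_def by metis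
  note left = nabla left_connection_const_connection[OF assms(1)]
  have eq: "nabla (\<lambda>i. cls l (w i)) = const_connection l \<Gamma> (\<lambda>i. cls l (w i))" for w
  proof -
    let ?t = "\<lambda>i. lmult1 l (cls l (w i)) (sform l i)"
    have "cls l (w i) = add1 l (?t 1) (add1 l (?t 2) (?t 3)) i" for i
      using exhaust_3[of i] by (elim disjE) (simp_all add: add1_def lmult1_def sform_cls)
    then have decomp: "(\<lambda>i. cls l (w i)) = add1 l (?t 1) (add1 l (?t 2) (?t 3))"
      by (rule ext)
    have "nabla (?t i) = const_connection l \<Gamma> (?t i)" for i
      by (simp only: leibniz[OF left(1) cls_carrier closed(1)] leibniz[OF left(2) cls_carrier closed(1)] sform)
    then show ?thesis
      unfolding decomp by (simp only: add[OF left(1)] add[OF left(2)] closed closed_add)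
  qed
  show ?thesis
  proof (rule PiE_ext)
    show "nabla \<in> Omega1 l \<rightarrow>\<^sub>E Omega11 l" "const_connection l \<Gamma> \<in> Omega1 l \<rightarrow>\<^sub>E Omega11 l"
      using left by (auto simp: left_connection_def)
  qed (use eq in \<open>auto simp: Omega1_cls\<close>)
qed

section \<open>The braiding of a connection with constant coefficients\<close>

lemma is_braiding_tensor_flip:
  assumes "l \<noteq> 0"
  shows "is_braiding l (const_connection l \<Gamma>) (tensor_flip l)"
proof -
  have "tensor_flip l \<in> Omega11 l \<rightarrow>\<^sub>E Omega11 l"
    by (auto simp: tensor_flip_def Omega11_def)
  then have "bimodule_map2 l (tensor_flip l)"
    unfolding bimodule_map2_def ball_Omega11 ball_fuzzy_sphere
    by (simp add: add2_def lmult2_def rmult2_def)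
  \<comment> \<open>For \<open>f = w q\<close> the surplus \<open>f * free_d l p a\<close> is the
    entry \<open>q p\<close> of the tensor of \<open>w\<close> with \<open>da\<close>, hence the
    entry \<open>p q\<close> of its flip. The constants pass \<open>a\<close> by centrality.\<close>
  moreover have leibniz: "free_d l p (f * a) + (\<Sum>i\<in>UNIV. w i * a * free_const (c i))
      = (free_d l p f + (\<Sum>i\<in>UNIV. w i * free_const (c i))) * a + f * free_d l p a"
    for p f a c and w :: "3 \<Rightarrow> free_alg"
    by (simp add: free_d_mult distrib_right sum_distrib_right mult.assoc free_const_central[of a])
  ultimately show ?thesis
    unfolding is_braiding_def ball_Omega1 ball_fuzzy_sphere
    by (simp only: add2_def rmult1_def rmult2_def tensor_def const_connection_cls[OF assms]
        dA_cls[OF assms] tensor_flip_cls cls_add cls_mult leibniz simp_thms)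
qed

text \<open>The braiding equation fixes the value on every tensor of a form with an exact form, and
  additivity carries this to all tensors because the \<open>d x_i\<close> generate the
  one-forms.\<close>

lemma is_braiding_unique:
  assumes l: "l \<noteq> 0" "l \<noteq> 1" "l \<noteq> - 1"
    and nabla: "nabla \<in> Omega1 l \<rightarrow> Omega11 l"
    and br: "is_braiding l nabla \<sigma>" "is_braiding l nabla \<sigma>'"
  shows "\<sigma> = \<sigma>'"
proof -
  have PiE: "s \<in> Omega11 l \<rightarrow>\<^sub>E Omega11 l" if "is_braiding l nabla s" for s
    using that by (auto simp: is_braiding_def bimodule_map2_def)
  have add: "s (add2 l S T) = add2 l (s S) (s T)"
    if "is_braiding l nabla s" "S \<in> Omega11 l" "T \<in> Omega11 l" for s S T
    using that unfolding is_braiding_def bimodule_map2_def by blast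
  have closed: "tensor l (\<lambda>i. cls l (w i)) (dA l (cls l f)) \<in> Omega11 l" for w f
    by (simp add: tensor_def dA_cls[OF l(1)])
  have closed_add: "add2 l S T \<in> Omega11 l" if "S \<in> Omega11 l" "T \<in> Omega11 l" for S T
    using that unfolding Omega11_cls by (auto simp: add2_def)
  have tensor_d: "\<sigma> (tensor l (\<lambda>i. cls l (w i)) (dA l (cls l f))) = \<sigma>' (tensor l (\<lambda>i. cls l (w i)) (dA l (cls l f)))"
    for w f
  proof -
    let ?T = "tensor l (\<lambda>i. cls l (w i)) (dA l (cls l f))"
    obtain s s' where s: "\<sigma> ?T = (\<lambda>i j. cls l (s i j))" and s': "\<sigma>' ?T = (\<lambda>i j. cls l (s' i j))"
      using PiE[OF br(1)] PiE[OF br(2)] closed[of w f] unfolding Omega11_cls by blast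
    obtain n where n: "nabla (\<lambda>i. cls l (w i)) = (\<lambda>i j. cls l (n i j))"
      using nabla cls_Omega1[of l w] unfolding Omega11_cls by blast
    have "add2 l (rmult2 l (nabla (\<lambda>i. cls l (w i))) (cls l f)) (\<sigma> ?T)
        = add2 l (rmult2 l (nabla (\<lambda>i. cls l (w i))) (cls l f)) (\<sigma>' ?T)"
      using br cls_carrier[of l f] cls_Omega1[of l w] unfolding is_braiding_def by metis
    then show ?thesis
      unfolding n s s' by (simp add: add2_def rmult2_def fun_eq_iff cls_eq_iff)
  qed
  have eq: "\<sigma> (\<lambda>i j. cls l (t i j)) = \<sigma>' (\<lambda>i j. cls l (t i j))" for t
  proof -
    \<comment> \<open>Replacing the second factor \<open>s^a\<close> by its expansion in the
      \<open>d x_i\<close> and moving the coefficients to the left factor.\<close>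
    let ?T = "\<lambda>i. tensor l (\<lambda>p. cls l (\<Sum>a\<in>UNIV. t p a * gen_coeff l a i)) (dA l (cls l (free_gen i)))"
    have "cls l (t p k) = add2 l (?T 1) (add2 l (?T 2) (?T 3)) p k" for p k
    proof -
      have "t p k = (\<Sum>a\<in>UNIV. t p a * (if k = a then 1 else 0))"
        by (simp add: if_distrib cong: if_cong)
      then have "cls l (t p k) = cls l (\<Sum>a\<in>UNIV. t p a * (if k = a then 1 else 0))"
        by simp
      also have "\<dots> = cls l (\<Sum>a\<in>UNIV. t p a * (\<Sum>i\<in>UNIV. gen_coeff l a i * free_d l k (free_gen i)))"
        by (intro cls_cong_sum cls_cong_mult refl sum_gen_coeff[OF l, symmetric])
      also have "(\<Sum>a\<in>UNIV. t p a * (\<Sum>i\<in>UNIV. gen_coeff l a i * free_d l k (free_gen i)))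
          = (\<Sum>i\<in>UNIV. (\<Sum>a\<in>UNIV. t p a * gen_coeff l a i) * free_d l k (free_gen i))"
        unfolding sum_distrib_left sum_distrib_right mult.assoc by (rule sum.swap)
      finally show ?thesis
        by (simp add: add2_def tensor_def dA_cls[OF l(1)] sum_3[of "\<lambda>i. _ i * free_d l k (free_gen i)"] add.assoc)
    qed
    then have decomp: "(\<lambda>i j. cls l (t i j)) = add2 l (?T 1) (add2 l (?T 2) (?T 3))"
      by (intro ext)
    show ?thesis
      unfolding decomp by (simp only: add[OF br(1)] add[OF br(2)] closed closed_add tensor_d)
  qed
  show ?thesis
  proof (rule PiE_ext)
    show "\<sigma> \<in> Omega11 l \<rightarrow>\<^sub>E Omega11 l" "\<sigma>' \<in> Omega11 l \<rightarrow>\<^sub>E Omega11 l"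
      using br PiE by blast+
  qed (use eq in \<open>auto simp: Omega11_cls\<close>)
qed

lemma bimodule_connection_const_connection: "l \<noteq> 0 \<Longrightarrow> bimodule_connection l (const_connection l \<Gamma>)"
  using left_connection_const_connection is_braiding_tensor_flip
  unfolding bimodule_connection_def by blast

lemma braiding_const_connection:
  assumes "l \<noteq> 0" "l \<noteq> 1" "l \<noteq> - 1"
  shows "braiding l (const_connection l \<Gamma>) = tensor_flip l"
proof -
  have "const_connection l \<Gamma> \<in> Omega1 l \<rightarrow>\<^sub>E Omega11 l"
    using left_connection_const_connection[OF assms(1)] by (simp add: left_connection_def)
  then have "const_connection l \<Gamma> \<in> Omega1 l \<rightarrow> Omega11 l"
    by (auto dest: PiE_mem)
  from is_braiding_unique[OF assms this] is_braiding_tensor_flip[OF assms(1)] show ?thesis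
    unfolding braiding_def by (intro the_equality) auto
qed

section \<open>Torsion in terms of the coefficients\<close>

lemma wedge_relations_cls:
  "(\<lambda>i j. cls l (u i j)) \<in> wedge_relations l \<longleftrightarrow> (\<forall>i j. cls l (u i j) = cls l (u j i))"
proof
  assume "(\<lambda>i j. cls l (u i j)) \<in> wedge_relations l"
  then obtain c where c: "(\<lambda>i j. cls l (u i j)) = (\<lambda>i j. cls l (c i j) \<oplus>\<^bsub>\<A> l\<^esub> cls l (c j i))"
    by (auto simp: wedge_relations_def Omega11_cls)
  then have "cls l (u i j) = cls l (c i j + c j i)" for i j
    by (simp add: fun_eq_iff)
  then show "\<forall>i j. cls l (u i j) = cls l (u j i)" by (simp add: add.commute)
next
  assume sym: "\<forall>i j. cls l (u i j) = cls l (u j i)"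
  \<comment> \<open>A symmetric tensor is the symmetrization of its half, so the relations are
    exactly the symmetric tensors.\<close>
  let ?C = "\<lambda>i j. cls l (free_const (1 / 2) * u i j)"
  have half: "free_const (1 / 2) * f + free_const (1 / 2) * f = f" for f
    by (simp only: distrib_right[symmetric] free_const_add[symmetric]) simp
  have "cls l (u i j) = cls l (free_const (1 / 2) * u i j + free_const (1 / 2) * u j i)" for i j
    using cls_cong_add[OF refl cls_cong_mult[OF refl sym[rule_format]]] half by metis
  then have "(\<lambda>i j. cls l (u i j)) = (\<lambda>i j. ?C i j \<oplus>\<^bsub>\<A> l\<^esub> ?C j i)"
    by (simp add: fun_eq_iff)
  then show "(\<lambda>i j. cls l (u i j)) \<in> wedge_relations l"
    unfolding wedge_relations_def by (intro CollectI exI[of _ ?C] conjI cls_Omega11)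
qed

text \<open>Wedge classes are sets of tensors; they are classes of the equivalence relation of
  having a symmetric difference.\<close>

lemma wedge_eq_iff:
  "wedge l (\<lambda>i j. cls l (s i j)) = wedge l (\<lambda>i j. cls l (t i j)) \<longleftrightarrow>
    (\<forall>i j. cls l (s i j - t i j) = cls l (s j i - t j i))"
proof -
  define sim where "sim s t \<longleftrightarrow> (\<forall>i j. cls l (s i j - t i j) = cls l (s j i - t j i))"
    for s t :: "3 \<Rightarrow> 3 \<Rightarrow> free_alg"
  have mem: "(\<lambda>i j. cls l (u i j)) \<in> wedge l (\<lambda>i j. cls l (t i j)) \<longleftrightarrow> sim u t" for u t
    by (simp add: wedge_def wedge_relations_cls sim_def)
  have sim_refl: "sim s s" for s
    by (simp add: sim_def)
  have sym: "sim t s" if "sim s t" for s t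
    unfolding sim_def
  proof (intro allI)
    fix i j
    have "cls l (0 - (s i j - t i j)) = cls l (0 - (s j i - t j i))"
      by (rule cls_cong_diff[OF refl that[unfolded sim_def, rule_format]])
    then show "cls l (t i j - s i j) = cls l (t j i - s j i)" by simp
  qed
  have trans: "sim u t" if "sim u s" "sim s t" for u s t
    unfolding sim_def
  proof (intro allI)
    fix i j
    have "cls l ((u i j - s i j) + (s i j - t i j)) = cls l ((u j i - s j i) + (s j i - t j i))"
      by (rule cls_cong_add[OF that[unfolded sim_def, rule_format]])
    then show "cls l (u i j - t i j) = cls l (u j i - t j i)" by simp
  qed
  have elem: "\<exists>u. T' = (\<lambda>i j. cls l (u i j))" if "T' \<in> wedge l T" for T T'
    using that by (auto simp: wedge_def Omega11_cls)
  have "wedge l (\<lambda>i j. cls l (s i j)) = wedge l (\<lambda>i j. cls l (t i j)) \<longleftrightarrow> sim s t"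
  proof
    assume "wedge l (\<lambda>i j. cls l (s i j)) = wedge l (\<lambda>i j. cls l (t i j))"
    then show "sim s t"
      using mem[of s s] mem[of s t] sim_refl by simp
  next
    assume "sim s t"
    then have "sim u s \<longleftrightarrow> sim u t" for u
      using sym trans by blast
    then show "wedge l (\<lambda>i j. cls l (s i j)) = wedge l (\<lambda>i j. cls l (t i j))"
      using elem mem by (intro equalityI subsetI) metis+
  qed
  then show ?thesis by (simp only: sim_def)
qed

text \<open>The derivative terms of the connection and of \<open>d\<close> agree and cancel, so the
  torsion is linear in the components of the form and can be tested on the basis.\<close>

lemma torsion_free_const_connection:
  assumes "l \<noteq> 0"
  shows "torsion_free l (const_connection l \<Gamma>) \<longleftrightarrow>
    (\<forall>i p q. \<Gamma> i p q - \<Gamma> i q p = 2 * of_real (eps i p q))"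
proof -
  have d: "dOmega1 l (\<lambda>i. cls l (w i)) = wedge l (\<lambda>p q. cls l (free_d l p (w q)
      + (\<Sum>i\<in>UNIV. w i * free_const (- 1 / 2 * of_real (eps i p q)))))" for w
  proof -
    have "(\<Sum>i\<in>UNIV. free_d l p (w i) * (if q = i then 1 else 0)) = free_d l p (w q)" for p q
      by (simp add: if_distrib cong: if_cong)
    then show ?thesis
      by (simp add: dOmega1_def dA_cls[OF assms] tensor_def sform_cls scalar_cls sum.distrib)
  qed
  have "torsion_free l (const_connection l \<Gamma>) \<longleftrightarrow>
      (\<forall>w p q. (\<Sum>i\<in>UNIV. w i * free_const (- 1 / 2 * (\<Gamma> i p q - \<Gamma> i q p - 2 * of_real (eps i p q)))) \<in> sphere_ideal l)"
  proof -
    have "(\<Sum>i\<in>UNIV. w i * free_const (- 1 / 2 * \<Gamma> i p q)) - (\<Sum>i\<in>UNIV. w i * free_const (- 1 / 2 * of_real (eps i p q)))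
        - ((\<Sum>i\<in>UNIV. w i * free_const (- 1 / 2 * \<Gamma> i q p)) - (\<Sum>i\<in>UNIV. w i * free_const (- 1 / 2 * of_real (eps i q p))))
        = (\<Sum>i\<in>UNIV. w i * free_const (- 1 / 2 * (\<Gamma> i p q - \<Gamma> i q p - 2 * of_real (eps i p q))))"
      for w :: "3 \<Rightarrow> free_alg" and p q
    proof -
      have "free_const (- 1 / 2 * \<Gamma> i p q) - free_const (- 1 / 2 * of_real (eps i p q))
          - (free_const (- 1 / 2 * \<Gamma> i q p) - free_const (- 1 / 2 * of_real (eps i q p)))
          = free_const (- 1 / 2 * (\<Gamma> i p q - \<Gamma> i q p - 2 * of_real (eps i p q)))" for i
        by (simp only: diff_conv_add_uminus free_const_add[symmetric] free_const_minus[symmetric])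
           (rule arg_cong[where f = free_const], simp add: eps_swap[of i q p] field_simps)
      then show ?thesis
        by (simp only: sum_subtractf[symmetric] right_diff_distrib[symmetric])
    qed
    then show ?thesis
      unfolding torsion_free_def ball_Omega1
      by (simp only: const_connection_cls[OF assms] d wedge_eq_iff cls_eq_iff add_diff_cancel_left)
  qed
  also have "\<dots> \<longleftrightarrow> (\<forall>i p q. \<Gamma> i p q - \<Gamma> i q p = 2 * of_real (eps i p q))"
  proof
    assume *: "\<forall>w p q. (\<Sum>i\<in>UNIV. w i * free_const (- 1 / 2 * (\<Gamma> i p q - \<Gamma> i q p - 2 * of_real (eps i p q)))) \<in> sphere_ideal l"
    show "\<forall>i p q. \<Gamma> i p q - \<Gamma> i q p = 2 * of_real (eps i p q)"
    proof (intro allI)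
      fix i p q
      \<comment> \<open>Evaluation at \<open>s^i\<close> places a constant in the ideal, which must
        therefore be zero.\<close>
      have "(\<Sum>m\<in>UNIV. (if m = i then 1 else 0) * free_const (- 1 / 2 * (\<Gamma> m p q - \<Gamma> m q p - 2 * of_real (eps m p q))))
          = free_const (- 1 / 2 * (\<Gamma> i p q - \<Gamma> i q p - 2 * of_real (eps i p q)))"
        by (simp add: if_distrib[of "\<lambda>x. x * y" for y] cong: if_cong)
      with *[rule_format, of "\<lambda>m. if m = i then 1 else 0" p q]
      have "- 1 / 2 * (\<Gamma> i p q - \<Gamma> i q p - 2 * of_real (eps i p q)) = 0"
        by (simp only: free_const_sphere_ideal[OF assms])
      then show "\<Gamma> i p q - \<Gamma> i q p = 2 * of_real (eps i p q)" by simp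
    qed
  next
    assume "\<forall>i p q. \<Gamma> i p q - \<Gamma> i q p = 2 * of_real (eps i p q)"
    then show "\<forall>w p q. (\<Sum>i\<in>UNIV. w i * free_const (- 1 / 2 * (\<Gamma> i p q - \<Gamma> i q p - 2 * of_real (eps i p q)))) \<in> sphere_ideal l"
      by (simp add: sphere_ideal_0)
  qed
  finally show ?thesis .
qed

section \<open>Metric compatibility and the star in terms of the coefficients\<close>

lemma metric_compatible_const_connection:
  assumes "l \<noteq> 0" "l \<noteq> 1" "l \<noteq> - 1"
  shows "metric_compatible l g (const_connection l \<Gamma>) \<longleftrightarrow>
    (\<forall>p q r. (\<Sum>i\<in>UNIV. of_real (g $ i $ r) * \<Gamma> i p q) + (\<Sum>j\<in>UNIV. of_real (g $ q $ j) * \<Gamma> j p r) = 0)"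
proof -
  have delta1: "(\<Sum>j\<in>UNIV. free_const (c j) * (if r = j then 1 else 0)) = free_const (c r)" for c and r :: 3
    by (simp add: if_distrib cong: if_cong)
  have delta2: "(\<Sum>i\<in>UNIV. \<Sum>j\<in>UNIV. free_const (c i j) * (if r = i then 1 else 0) * free_const (c' j))
      = (\<Sum>j\<in>UNIV. free_const (c r j * c' j))" for c c' and r :: 3
  proof -
    have "(\<Sum>i\<in>UNIV. \<Sum>j\<in>UNIV. free_const (c i j) * (if r = i then 1 else 0) * free_const (c' j))
        = (\<Sum>i\<in>UNIV. if r = i then \<Sum>j\<in>UNIV. free_const (c i j * c' j) else 0)"
      by (intro sum.cong) (auto simp: free_const_mult)
    then show ?thesis by simp
  qed
  have one: "nabla_id_metric l g (const_connection l \<Gamma>) p q r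
      = cls l (free_const (\<Sum>i\<in>UNIV. - 1 / 2 * of_real (g $ i $ r) * \<Gamma> i p q))" for p q r
    unfolding nabla_id_metric_def tensor21_def const_connection_smult_sform[OF assms(1)]
    unfolding sform_cls cls_mult cls_finsum[OF finite_class.finite_UNIV] delta1 free_const_sum ..
  \<comment> \<open>An equation of functions, because \<open>map_id\<close> takes the whole tensor
    as its argument.\<close>
  have two: "id_nabla_metric l g (const_connection l \<Gamma>)
      = (\<lambda>p q r. cls l (free_const (\<Sum>j\<in>UNIV. of_real (g $ p $ j) * (- 1 / 2 * \<Gamma> j q r))))"
    unfolding id_nabla_metric_def tensor12_def const_connection_sform[OF assms(1)]
    unfolding lmult1_def sform_cls scalar_cls cls_mult cls_finsum[OF finite_class.finite_UNIV] delta2 free_const_sum ..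
  \<comment> \<open>The flip exchanges the first two indices, so the second term at
    \<open>p q r\<close> is the entry \<open>q p r\<close> of \<open>two\<close>.\<close>
  have "metric_compatible l g (const_connection l \<Gamma>) \<longleftrightarrow>
      (\<forall>p q r. (\<Sum>i\<in>UNIV. - 1 / 2 * of_real (g $ i $ r) * \<Gamma> i p q)
        + (\<Sum>j\<in>UNIV. of_real (g $ q $ j) * (- 1 / 2 * \<Gamma> j p r)) = 0)"
    unfolding metric_compatible_def map_id_def braiding_const_connection[OF assms] one two tensor_flip_cls
      cls_add free_const_add[symmetric] zero_fuzzy_sphere cls_eq_iff diff_0_right
      free_const_sphere_ideal[OF assms(1)] ..
  also have "\<dots> \<longleftrightarrow> (\<forall>p q r. - 1 / 2 * ((\<Sum>i\<in>UNIV. of_real (g $ i $ r) * \<Gamma> i p q)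
        + (\<Sum>j\<in>UNIV. of_real (g $ q $ j) * \<Gamma> j p r)) = 0)"
    by (simp only: distrib_left sum_distrib_left mult.assoc mult.left_commute)
  finally show ?thesis by (simp only: mult_eq_0_iff) simp
qed

text \<open>The braiding undoes the flip inside \<open>flip_star\<close>, so each component has to
  commute with the star: the derivative does by \<open>free_d_star\<close>, the coefficients because
  they are real.\<close>

lemma star_preserving_const_connection:
  assumes "l \<noteq> 0" "l \<noteq> 1" "l \<noteq> - 1" and "\<And>i j k. \<Gamma> i j k \<in> \<real>"
  shows "star_preserving l (const_connection l \<Gamma>)"
proof -
  have "cnj (\<Gamma> i j k) = \<Gamma> i j k" for i j k
    using assms(4) by (simp add: Reals_cnj_iff)
  then have "free_star (free_d l p (w q) + (\<Sum>i\<in>UNIV. w i * free_const (- 1 / 2 * \<Gamma> i p q)))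
      = free_d l p (free_star (w q)) + (\<Sum>i\<in>UNIV. free_star (w i) * free_const (- 1 / 2 * \<Gamma> i p q))" for p q w
    by (simp add: free_star_add free_star_sum free_star_mult free_d_star free_const_central)
  then show ?thesis
    unfolding star_preserving_def ball_Omega1 star1_def flip_star_def
      braiding_const_connection[OF assms(1-3)] const_connection_cls[OF assms(1)] star_cls tensor_flip_cls
    by simp
qed

section \<open>Solving for the coefficients\<close>

text \<open>A left inverse of the metric raises the index again.\<close>

lemma lower_index_eqI:
  assumes "invertible g" and "\<And>i j k. lower_index g \<Gamma> i j k = lower_index g \<Gamma>' i j k"
  shows "\<Gamma> = \<Gamma>'"
proof (intro ext)
  fix i j k
  obtain h where h: "h ** g = mat 1"
    using assms(1) by (auto simp: invertible_def)
  have raise: "\<Gamma> i j k = (\<Sum>m\<in>UNIV. of_real (h $ i $ m) * lower_index g \<Gamma> m j k)" for \<Gamma> :: "3 \<Rightarrow> 3 \<Rightarrow> 3 \<Rightarrow> complex"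
  proof -
    have "(\<Sum>m\<in>UNIV. h $ i $ m * g $ m $ n) = (if i = n then 1 else 0)" for n
      using arg_cong[OF h, of "\<lambda>x. x $ i $ n"] by (simp add: matrix_matrix_mult_def mat_def)
    then have *: "(\<Sum>m\<in>UNIV. of_real (h $ i $ m) * of_real (g $ m $ n)) = (if i = n then 1 else 0 :: complex)" for n
      by (metis (no_types, lifting) of_real_0 of_real_1 of_real_mult of_real_sum sum.cong)
    have "(\<Sum>m\<in>UNIV. of_real (h $ i $ m) * lower_index g \<Gamma> m j k)
        = (\<Sum>n\<in>UNIV. (\<Sum>m\<in>UNIV. of_real (h $ i $ m) * of_real (g $ m $ n)) * \<Gamma> n j k)"
      unfolding lower_index_def sum_distrib_left sum_distrib_right mult.assoc by (rule sum.swap)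
    also have "\<dots> = \<Gamma> i j k"
      by (simp add: * if_distrib[of "\<lambda>x. x * y" for y] cong: if_cong)
    finally show ?thesis by simp
  qed
  show "\<Gamma> i j k = \<Gamma>' i j k"
    unfolding raise[of \<Gamma>] raise[of \<Gamma>'] assms(2) ..
qed

text \<open>Raising with a right inverse of the real matrix \<open>g\<close> keeps real data real;
  the reality of the connection coefficients rests on this.\<close>

lemma lower_index_surj:
  assumes "invertible g"
  obtains \<Gamma> where "\<And>i j k. \<Gamma> i j k \<in> \<real>" and "\<And>i j k. lower_index g \<Gamma> i j k = of_real (L i j k)"
proof -
  obtain h where h: "g ** h = mat 1"
    using assms(1) by (auto simp: invertible_def)
  have *: "(\<Sum>m\<in>UNIV. g $ i $ m * h $ m $ n) = (if i = n then 1 else 0)" for i n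
    using arg_cong[OF h, of "\<lambda>x. x $ i $ n"] by (simp add: matrix_matrix_mult_def mat_def)
  have "lower_index g (\<lambda>i j k. of_real (\<Sum>m\<in>UNIV. h $ i $ m * L m j k)) i j k = of_real (L i j k)" for i j k
  proof -
    have "(\<Sum>n\<in>UNIV. g $ i $ n * (\<Sum>m\<in>UNIV. h $ n $ m * L m j k))
        = (\<Sum>m\<in>UNIV. (\<Sum>n\<in>UNIV. g $ i $ n * h $ n $ m) * L m j k)"
      unfolding sum_distrib_left sum_distrib_right mult.assoc by (rule sum.swap)
    also have "\<dots> = L i j k"
      by (simp add: * if_distrib[of "\<lambda>x. x * y" for y] cong: if_cong)
    finally show ?thesis
      unfolding lower_index_def by (simp only: of_real_mult[symmetric] of_real_sum[symmetric])
  qed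
  then show ?thesis by (intro that[of "\<lambda>i j k. of_real (\<Sum>m\<in>UNIV. h $ i $ m * L m j k)"]) auto
qed

text \<open>\<open>?M\<close> is antisymmetry in the two outer indices. It makes the alternating
  combination of three torsion equations collapse to \<open>2 * L i j k\<close>; conversely,
  antisymmetry of \<open>t\<close> in its last two indices recovers both conditions.\<close>

lemma koszul:
  fixes L t :: "'i \<Rightarrow> 'i \<Rightarrow> 'i \<Rightarrow> 'a :: field_char_0"
  assumes "\<And>i j k. t i k j = - t i j k"
  shows "(\<forall>i j k. L i j k - L i k j = t i j k) \<and> (\<forall>i j k. L k i j + L j i k = 0) \<longleftrightarrow>
    (\<forall>i j k. 2 * L i j k = t i j k - t j k i + t k i j)" (is "?T \<and> ?M \<longleftrightarrow> ?K")
proof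
  assume TM: "?T \<and> ?M"
  show ?K
  proof (intro allI)
    fix i j k
    have "L i k j = - L j k i" "L j i k = - L k i j" "L k j i = - L i j k"
      using TM by (auto simp: eq_neg_iff_add_eq_0)
    moreover have "t i j k = L i j k - L i k j" "t j k i = L j k i - L j i k" "t k i j = L k i j - L k j i"
      using TM by auto
    ultimately show "2 * L i j k = t i j k - t j k i + t k i j" by simp
  qed
next
  assume K: ?K
  show "?T \<and> ?M"
  proof (intro conjI allI)
    fix i j k
    have "2 * (L i j k - L i k j) = 2 * t i j k"
      using K assms[of i j k] assms[of j i k] assms[of k j i] by (simp add: right_diff_distrib)
    then show "L i j k - L i k j = t i j k" by (simp only: mult_cancel_left) simp
    have "2 * (L k i j + L j i k) = 0"
      using K assms[of k j i] assms[of j k i] assms[of i j k] by (simp add: distrib_left)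
    then show "L k i j + L j i k = 0" by (simp only: mult_eq_0_iff) simp
  qed
qed

lemma quantum_Levi_Civita_const_connection:
  assumes "l \<noteq> 0" "l \<noteq> 1" "l \<noteq> - 1" and "quantum_metric g"
  shows "quantum_Levi_Civita l g (const_connection l \<Gamma>) \<longleftrightarrow> (\<forall>i j k. lower_index g \<Gamma> i j k =
    of_real (2 * (\<Sum>m\<in>UNIV. eps i k m * g $ m $ j) + trace g * eps i j k))"
proof -
  have sym: "g $ i $ j = g $ j $ i" for i j
  proof -
    have "transpose g $ j $ i = g $ j $ i"
      using assms(4) by (simp add: quantum_metric_def)
    then show ?thesis by (simp add: transpose_def)
  qed
  have inv: "invertible g"
    using assms(4) by (simp add: quantum_metric_def)
  define t where "t i j k = complex_of_real (2 * (\<Sum>m\<in>UNIV. g $ i $ m * eps m j k))" for i j k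
  have t: "lower_index g (\<lambda>i j k. 2 * of_real (eps i j k)) = t"
    by (simp add: fun_eq_iff lower_index_def t_def sum_distrib_left mult.left_commute)
  have "(\<forall>i p q. \<Gamma> i p q - \<Gamma> i q p = 2 * of_real (eps i p q)) \<longleftrightarrow>
      (\<lambda>i p q. \<Gamma> i p q - \<Gamma> i q p) = (\<lambda>i p q. 2 * of_real (eps i p q))"
    by (simp add: fun_eq_iff)
  \<comment> \<open>Lowering with an invertible metric is injective, so the torsion equation may be
    lowered without loss.\<close>
  also have "\<dots> \<longleftrightarrow> (\<forall>i p q. lower_index g (\<lambda>i p q. \<Gamma> i p q - \<Gamma> i q p) i p q = t i p q)"
    unfolding t[symmetric]
    by (rule iffI, simp only:, simp, rule lower_index_eqI[OF inv], blast)
  also have "\<dots> \<longleftrightarrow> (\<forall>i p q. lower_index g \<Gamma> i p q - lower_index g \<Gamma> i q p = t i p q)"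
    by (simp add: lower_index_def right_diff_distrib sum_subtractf)
  finally have torsion: "torsion_free l (const_connection l \<Gamma>) \<longleftrightarrow>
      (\<forall>i p q. lower_index g \<Gamma> i p q - lower_index g \<Gamma> i q p = t i p q)"
    by (simp only: torsion_free_const_connection[OF assms(1)])
  \<comment> \<open>Symmetry of \<open>g\<close> turns the first sum into a lowered
    coefficient.\<close>
  have metric: "metric_compatible l g (const_connection l \<Gamma>) \<longleftrightarrow>
      (\<forall>p q r. lower_index g \<Gamma> r p q + lower_index g \<Gamma> q p r = 0)"
    unfolding metric_compatible_const_connection[OF assms(1-3)] lower_index_def
    by (subst sym) (rule refl)
  have "t i k j = - t i j k" for i j k
    by (simp add: t_def eps_swap[of _ k j] sum_negf)
  note koszul[of t "lower_index g \<Gamma>", OF this]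
  moreover have "t i j k - t j k i + t k i j =
      2 * of_real (2 * (\<Sum>m\<in>UNIV. eps i k m * g $ m $ j) + trace g * eps i j k)" for i j k
  proof -
    \<comment> \<open>With three plus signs the left side would be
      \<open>trace g * eps i j k\<close>, the linearized determinant identity. The minus sign
      subtracts the middle sum twice, which by symmetry of \<open>g\<close> is the
      \<open>eps i k m\<close> term.\<close>
    have "(\<Sum>m\<in>UNIV. g $ i $ m * eps m j k) - (\<Sum>m\<in>UNIV. g $ j $ m * eps m k i) + (\<Sum>m\<in>UNIV. g $ k $ m * eps m i j)
        = 2 * (\<Sum>m\<in>UNIV. eps i k m * g $ m $ j) + trace g * eps i j k"
      using exhaust_3[of i] exhaust_3[of j] exhaust_3[of k] sym[of 2 1] sym[of 3 1] sym[of 3 2]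
      by (elim disjE) (simp_all add: sum_3 trace_def)
    from arg_cong[OF this, of "\<lambda>x. 2 * x"]
    have "2 * (\<Sum>m\<in>UNIV. g $ i $ m * eps m j k) - 2 * (\<Sum>m\<in>UNIV. g $ j $ m * eps m k i)
        + 2 * (\<Sum>m\<in>UNIV. g $ k $ m * eps m i j)
        = 2 * (2 * (\<Sum>m\<in>UNIV. eps i k m * g $ m $ j) + trace g * eps i j k)"
      by (simp only: right_diff_distrib distrib_left)
    then show ?thesis
      unfolding t_def of_real_diff[symmetric] of_real_add[symmetric]
      by (simp only: of_real_mult of_real_numeral)
  qed
  moreover have "2 * x = 2 * y \<longleftrightarrow> x = y" for x y :: complex
    by simp
  ultimately show ?thesis
    unfolding quantum_Levi_Civita_def torsion metric
    by (simp only: bimodule_connection_const_connection[OF assms(1)] simp_thms)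
qed

theorem proposition3p4:
  fixes l :: real and g :: "real^3^3"
  assumes "l \<noteq> 0" and "l \<noteq> 1" and "l \<noteq> - 1"
    and "quantum_metric g"
  shows "(\<exists>!nabla. quantum_Levi_Civita l g nabla \<and> (\<exists>\<Gamma>. has_coefficients l nabla \<Gamma>)) \<and>
    (\<forall>nabla \<Gamma>. quantum_Levi_Civita l g nabla \<and> has_coefficients l nabla \<Gamma> \<longrightarrow>
       (\<forall>i j k. lower_index g \<Gamma> i j k =
          of_real (2 * (\<Sum>m\<in>UNIV. eps i k m * g $ m $ j) + trace g * eps i j k)) \<and>
       (\<forall>i j k. \<Gamma> i j k \<in> \<real> \<and> lower_index g \<Gamma> i j k \<in> \<real>) \<and>
       star_preserving l nabla)"
proof -
  have inv: "invertible g"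
    using assms(4) by (simp add: quantum_metric_def)
  \<comment> \<open>The formula of the theorem is real, so it is the lowering of a real family; this
    family gives the connection.\<close>
  obtain \<Gamma> where real: "\<And>i j k. \<Gamma> i j k \<in> \<real>" and lower: "\<And>i j k. lower_index g \<Gamma> i j k =
      of_real (2 * (\<Sum>m\<in>UNIV. eps i k m * g $ m $ j) + trace g * eps i j k)"
    using lower_index_surj[OF inv, of "\<lambda>i j k. 2 * (\<Sum>m\<in>UNIV. eps i k m * g $ m $ j) + trace g * eps i j k"]
    by blast
  \<comment> \<open>Any competitor is itself a \<open>const_connection\<close> whose lowered
    coefficients obey the same formula, so injectivity of lowering identifies it with the
    solution.\<close>
  have unique: "\<Gamma>' = \<Gamma> \<and> nabla = const_connection l \<Gamma>"
    if qlc: "quantum_Levi_Civita l g nabla" and coeff: "has_coefficients l nabla \<Gamma>'" for nabla \<Gamma>'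
  proof -
    have nabla: "nabla = const_connection l \<Gamma>'"
      using const_connection_unique[OF assms(1) _ coeff] qlc
      by (simp add: quantum_Levi_Civita_def bimodule_connection_def)
    then have "lower_index g \<Gamma>' i j k = lower_index g \<Gamma> i j k" for i j k
      using qlc quantum_Levi_Civita_const_connection[OF assms] lower by simp
    then have "\<Gamma>' = \<Gamma>" by (rule lower_index_eqI[OF inv])
    with nabla show ?thesis by simp
  qed
  have "quantum_Levi_Civita l g (const_connection l \<Gamma>)"
    using quantum_Levi_Civita_const_connection[OF assms] lower by simp
  then have "\<exists>!nabla. quantum_Levi_Civita l g nabla \<and> (\<exists>\<Gamma>. has_coefficients l nabla \<Gamma>)"
    using has_coefficients_const_connection[OF assms(1)] unique by blast
  moreover have "lower_index g \<Gamma> i j k \<in> \<real>" for i j k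
    unfolding lower by (rule Reals_of_real)
  ultimately show ?thesis
    using lower real star_preserving_const_connection[OF assms(1-3) real] by (auto dest!: unique)
qed

end
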